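(* Let $J$ be a compact smooth manifold of real dimension $k$ with a smooth involution $\iota_J$ whose fixed point set is nonempty and isolated, and let $E$ be a quaternionic vector bundle over $J$ of complex rank $2l$. Set $m=l+\left[\frac{k+2}{4}\right]$, where $[x]$ denotes the largest integer not exceeding $x$. Then there is a $Pin(2)$-equivariant monomorphism from $E$ to $\underline{\mathbb H}^m$, i.e. a fibrewise injective homomorphism of complex vector bundles $\Phi:E\to\underline{\mathbb H}^m$ over $J$ with $\Phi\circ\iota_E=\iota_{\underline{\mathbb H}^m}\circ\Phi$.
   Context: A quaternionic vector bundle over $(J,\iota_J)$ is a complex vector bundle $E\to J$ together with a map $\iota_E:E\to E$ covering $\iota_J$, real-linear on fibres and anti-complex (i.e. $\iota_E(iu)=-i\,\iota_E(u)$), such that $\iota_E\circ\iota_E=-1$. Its rank means its complex rank. $\underline{\mathbb H}^m$ is the rank $2m$ quaternionic vector bundle $J\times\mathbb H^m$, with complex structure given by right multiplication by $i$ and $\iota_{\underline{\mathbb H}^m}(x,q)=(\iota_Jx,\,qj)$. The group $Pin(2)$ is generated by $U(1)$ and an element $\iota$ with $\iota^2=-1$ and $\iota z\iota^{-1}=z^{-1}$ for $z\in U(1)$; it acts on a quaternionic vector bundle $E$ with $U(1)$ acting by complex multiplication and $\iota$ acting by $\iota_E$, covering the action on $J$ through $Pin(2)\to\{\mathrm{id},\iota_J\}$. $J$ is without boundary. *)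

theory Defs
  imports "HOL-Analysis.Analysis" "HOL-Algebra.Module"
begin

section \<open>Smooth manifolds\<close>

text \<open>
  \<open>R^k\<close> is \<^term>\<open>Euclidean_space k\<close>, whose points are the sequences vanishing from index \<open>k\<close> on; this
  makes \<open>k = 0\<close> available. \<open>C_on n k V f\<close> says that all iterated partial derivatives of \<open>f\<close> of order
  at most \<open>n\<close> exist and are continuous on \<open>V\<close>, where \<open>V\<close> is meant to be open in \<open>R^k\<close>.
\<close>

primrec C_on :: "nat \<Rightarrow> nat \<Rightarrow> (nat \<Rightarrow> real) set \<Rightarrow> ((nat \<Rightarrow> real) \<Rightarrow> real) \<Rightarrow> bool" where
  "C_on 0 k V f \<longleftrightarrow> continuous_map (subtopology (Euclidean_space k) V) euclideanreal f"
| "C_on (Suc n) k V f \<longleftrightarrow>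
     continuous_map (subtopology (Euclidean_space k) V) euclideanreal f \<and>
     (\<forall>i<k. \<exists>g. (\<forall>x\<in>V. ((\<lambda>t. f (x(i := t))) has_real_derivative g x) (at (x i))) \<and> C_on n k V g)"

definition smooth_between ::
  "nat \<Rightarrow> nat \<Rightarrow> (nat \<Rightarrow> real) set \<Rightarrow> ((nat \<Rightarrow> real) \<Rightarrow> (nat \<Rightarrow> real)) \<Rightarrow> bool" where
  "smooth_between k k' V F \<longleftrightarrow> (\<forall>j<k'. \<forall>n. C_on n k V (\<lambda>x. F x j))"

definition chart :: "nat \<Rightarrow> 'a topology \<Rightarrow> 'a set \<times> ('a \<Rightarrow> nat \<Rightarrow> real) \<Rightarrow> bool" where
  "chart k J c \<longleftrightarrow> (case c of (U, \<phi>) \<Rightarrow>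
     openin J U \<and> openin (Euclidean_space k) (\<phi> ` U) \<and>
     homeomorphic_map (subtopology J U) (subtopology (Euclidean_space k) (\<phi> ` U)) \<phi>)"

text \<open>
  Smooth manifolds have no boundary and all components have the same dimension \<open>k\<close>. The atlas \<open>A\<close>
  need not be maximal.
\<close>

definition smooth_manifold ::
  "nat \<Rightarrow> 'a topology \<Rightarrow> ('a set \<times> ('a \<Rightarrow> nat \<Rightarrow> real)) set \<Rightarrow> bool" where
  "smooth_manifold k J A \<longleftrightarrow>
     Hausdorff_space J \<and> second_countable J \<and>
     (\<forall>c\<in>A. chart k J c) \<and> (\<Union>(U, \<phi>)\<in>A. U) = topspace J \<and>
     (\<forall>(U, \<phi>)\<in>A. \<forall>(V, \<psi>)\<in>A. smooth_between k k (\<phi> ` (U \<inter> V)) (\<lambda>x. \<psi> (inv_into U \<phi> x)))"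

definition smooth_map ::
  "nat \<Rightarrow> 'a topology \<Rightarrow> ('a set \<times> ('a \<Rightarrow> nat \<Rightarrow> real)) set \<Rightarrow>
   nat \<Rightarrow> 'b topology \<Rightarrow> ('b set \<times> ('b \<Rightarrow> nat \<Rightarrow> real)) set \<Rightarrow> ('a \<Rightarrow> 'b) \<Rightarrow> bool" where
  "smooth_map k J A k' J' A' f \<longleftrightarrow>
     continuous_map J J' f \<and>
     (\<forall>(U, \<phi>)\<in>A. \<forall>(V, \<psi>)\<in>A'.
        smooth_between k k' (\<phi> ` {x\<in>U. f x \<in> V}) (\<lambda>x. \<psi> (f (inv_into U \<phi> x))))"

definition smooth_involution ::
  "nat \<Rightarrow> 'a topology \<Rightarrow> ('a set \<times> ('a \<Rightarrow> nat \<Rightarrow> real)) set \<Rightarrow> ('a \<Rightarrow> 'a) \<Rightarrow> bool" where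
  "smooth_involution k J A \<iota>J \<longleftrightarrow>
     smooth_map k J A k J A \<iota>J \<and> (\<forall>x\<in>topspace J. \<iota>J (\<iota>J x) = x)"

definition fixed_points :: "'a topology \<Rightarrow> ('a \<Rightarrow> 'a) \<Rightarrow> 'a set" where
  "fixed_points J f = {x \<in> topspace J. f x = x}"

definition isolated_set :: "'a topology \<Rightarrow> 'a set \<Rightarrow> bool" where
  "isolated_set J S \<longleftrightarrow> subtopology J S = discrete_topology S"


section \<open>Complex vector bundles\<close>

definition complex_ring :: "complex ring" where
  "complex_ring = \<lparr>carrier = UNIV, mult = (*), one = 1, zero = 0, add = (+)\<rparr>"

text \<open>\<open>'v^n\<close>, encoded like \<^term>\<open>Euclidean_space n\<close>.\<close>

definition coord_space :: "nat \<Rightarrow> (nat \<Rightarrow> 'v::{topological_space,zero}) topology" where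
  "coord_space n = subtopology (product_topology (\<lambda>_. euclidean) UNIV) {x. \<forall>i\<ge>n. x i = 0}"

text \<open>
  The vector space structure of the fibre over \<open>x\<close> is the module \<open>fib E x\<close>, whose components
  \<open>mult\<close> and \<open>one\<close> play no role.
\<close>

record ('a, 'e) vbundle =
  total :: "'e topology"
  proj :: "'e \<Rightarrow> 'a"
  fib :: "'a \<Rightarrow> (complex, 'e) module"

definition local_trivialization ::
  "'a topology \<Rightarrow> ('a, 'e) vbundle \<Rightarrow> nat \<Rightarrow> 'a set \<Rightarrow> ('e \<Rightarrow> 'a \<times> (nat \<Rightarrow> complex)) \<Rightarrow> bool" where
  "local_trivialization J E r U h \<longleftrightarrow>
     homeomorphic_map (subtopology (total E) {u \<in> topspace (total E). proj E u \<in> U})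
       (prod_topology (subtopology J U) (coord_space r)) h \<and>
     (\<forall>u\<in>topspace (total E). proj E u \<in> U \<longrightarrow> fst (h u) = proj E u) \<and>
     (\<forall>x\<in>U. \<forall>u\<in>carrier (fib E x). \<forall>v\<in>carrier (fib E x).
        snd (h (u \<oplus>\<^bsub>fib E x\<^esub> v)) = (\<lambda>n. snd (h u) n + snd (h v) n)) \<and>
     (\<forall>x\<in>U. \<forall>c. \<forall>u\<in>carrier (fib E x).
        snd (h (c \<odot>\<^bsub>fib E x\<^esub> u)) = (\<lambda>n. c * snd (h u) n))"

definition complex_vector_bundle :: "'a topology \<Rightarrow> ('a, 'e) vbundle \<Rightarrow> nat \<Rightarrow> bool" where
  "complex_vector_bundle J E r \<longleftrightarrow>
     continuous_map (total E) J (proj E) \<and>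
     (\<forall>x\<in>topspace J. carrier (fib E x) = {u \<in> topspace (total E). proj E u = x} \<and>
        Module.module complex_ring (fib E x)) \<and>
     (\<forall>x\<in>topspace J. \<exists>U h. openin J U \<and> x \<in> U \<and> local_trivialization J E r U h)"

definition bundle_monomorphism ::
  "'a topology \<Rightarrow> ('a, 'e) vbundle \<Rightarrow> ('a, 'f) vbundle \<Rightarrow> ('e \<Rightarrow> 'f) \<Rightarrow> bool" where
  "bundle_monomorphism J E F \<Phi> \<longleftrightarrow>
     continuous_map (total E) (total F) \<Phi> \<and>
     (\<forall>u\<in>topspace (total E). proj F (\<Phi> u) = proj E u) \<and>
     (\<forall>x\<in>topspace J.
        (\<forall>u\<in>carrier (fib E x). \<forall>v\<in>carrier (fib E x).
           \<Phi> (u \<oplus>\<^bsub>fib E x\<^esub> v) = \<Phi> u \<oplus>\<^bsub>fib F x\<^esub> \<Phi> v) \<and>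
        (\<forall>c. \<forall>u\<in>carrier (fib E x). \<Phi> (c \<odot>\<^bsub>fib E x\<^esub> u) = c \<odot>\<^bsub>fib F x\<^esub> \<Phi> u) \<and>
        inj_on \<Phi> (carrier (fib E x)))"


section \<open>Quaternionic vector bundles\<close>

definition quaternionic_structure ::
  "'a topology \<Rightarrow> ('a \<Rightarrow> 'a) \<Rightarrow> ('a, 'e) vbundle \<Rightarrow> ('e \<Rightarrow> 'e) \<Rightarrow> bool" where
  "quaternionic_structure J \<iota>J E \<iota>E \<longleftrightarrow>
     continuous_map (total E) (total E) \<iota>E \<and>
     (\<forall>u\<in>topspace (total E). proj E (\<iota>E u) = \<iota>J (proj E u)) \<and>
     (\<forall>x\<in>topspace J.
        (\<forall>u\<in>carrier (fib E x). \<forall>v\<in>carrier (fib E x).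
           \<iota>E (u \<oplus>\<^bsub>fib E x\<^esub> v) = \<iota>E u \<oplus>\<^bsub>fib E (\<iota>J x)\<^esub> \<iota>E v) \<and>
        (\<forall>t::real. \<forall>u\<in>carrier (fib E x).
           \<iota>E (complex_of_real t \<odot>\<^bsub>fib E x\<^esub> u) = complex_of_real t \<odot>\<^bsub>fib E (\<iota>J x)\<^esub> \<iota>E u) \<and>
        (\<forall>u\<in>carrier (fib E x). \<iota>E (\<i> \<odot>\<^bsub>fib E x\<^esub> u) = (- \<i>) \<odot>\<^bsub>fib E (\<iota>J x)\<^esub> \<iota>E u) \<and>
        (\<forall>u\<in>carrier (fib E x). \<iota>E (\<iota>E u) = \<ominus>\<^bsub>fib E x\<^esub> u))"

definition quaternionic_vector_bundle ::
  "'a topology \<Rightarrow> ('a \<Rightarrow> 'a) \<Rightarrow> ('a, 'e) vbundle \<Rightarrow> ('e \<Rightarrow> 'e) \<Rightarrow> nat \<Rightarrow> bool" where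
  "quaternionic_vector_bundle J \<iota>J E \<iota>E r \<longleftrightarrow>
     complex_vector_bundle J E r \<and> quaternionic_structure J \<iota>J E \<iota>E"

text \<open>The pair \<open>(a, b)\<close> of complex numbers stands for the quaternion \<open>a + bj\<close>.\<close>

type_synonym quat = "complex \<times> complex"

definition qmult :: "quat \<Rightarrow> quat \<Rightarrow> quat" where
  "qmult p q = (fst p * fst q - snd p * cnj (snd q), fst p * snd q + snd p * cnj (fst q))"

definition qj :: quat where
  "qj = (0, 1)"

text \<open>The bundle \<open>J \<times> H^m\<close>, with the complex numbers acting by multiplication on the right.\<close>

definition trivial_quat_bundle :: "'a topology \<Rightarrow> nat \<Rightarrow> ('a, 'a \<times> (nat \<Rightarrow> quat)) vbundle" where
  "trivial_quat_bundle J m =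
     \<lparr>total = prod_topology J (coord_space m),
      proj = fst,
      fib = (\<lambda>x. \<lparr>carrier = {x} \<times> topspace (coord_space m),
                  mult = undefined, one = undefined,
                  zero = (x, \<lambda>_. 0),
                  add = (\<lambda>u v. (x, \<lambda>n. snd u n + snd v n)),
                  smult = (\<lambda>c u. (x, \<lambda>n. qmult (snd u n) (c, 0)))\<rparr>)\<rparr>"

definition trivial_quat_iota ::
  "('a \<Rightarrow> 'a) \<Rightarrow> 'a \<times> (nat \<Rightarrow> quat) \<Rightarrow> 'a \<times> (nat \<Rightarrow> quat)" where
  "trivial_quat_iota \<iota>J u = (\<iota>J (fst u), \<lambda>n. qmult (snd u n) qj)"

text \<open>
  \<open>Pin(2)\<close> as a group of unit quaternions, with \<open>\<iota> = j\<close>. Its elements are the \<open>z = (z, 0)\<close> and the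
  \<open>z\<iota> = (0, z)\<close> with \<open>z\<close> in \<open>U(1)\<close>.
\<close>

definition Pin2 :: "quat set" where
  "Pin2 = {(z, 0) |z. norm z = 1} \<union> {(0, z) |z. norm z = 1}"

definition Pin2_action ::
  "('a \<Rightarrow> 'a) \<Rightarrow> ('a, 'e) vbundle \<Rightarrow> ('e \<Rightarrow> 'e) \<Rightarrow> quat \<Rightarrow> 'e \<Rightarrow> 'e" where
  "Pin2_action \<iota>J E \<iota>E g u =
     (if snd g = 0 then fst g \<odot>\<^bsub>fib E (proj E u)\<^esub> u
      else snd g \<odot>\<^bsub>fib E (\<iota>J (proj E u))\<^esub> \<iota>E u)"

definition Pin2_equivariant ::
  "('a \<Rightarrow> 'a) \<Rightarrow> ('a, 'e) vbundle \<Rightarrow> ('e \<Rightarrow> 'e) \<Rightarrow> ('a, 'f) vbundle \<Rightarrow> ('f \<Rightarrow> 'f) \<Rightarrow> ('e \<Rightarrow> 'f) \<Rightarrow> bool" where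
  "Pin2_equivariant \<iota>J E \<iota>E F \<iota>F \<Phi> \<longleftrightarrow>
     (\<forall>g\<in>Pin2. \<forall>u\<in>topspace (total E).
        \<Phi> (Pin2_action \<iota>J E \<iota>E g u) = Pin2_action \<iota>J F \<iota>F g (\<Phi> u))"

end

theory Submission
  imports Defs "HOL-Library.Function_Algebras"
begin

text \<open>
  An equivariant monomorphism is built from scalar functions. Let \<open>a 0, ..., a (m - 1)\<close> be continuous
  functions on the total space of \<open>E\<close> that are complex-linear on the fibres. The map \<open>\<Phi>\<close> to \<open>H^m\<close> whose
  \<open>r\<close>-th entry is \<open>a r u - a r (\<iota>E u) j\<close> is complex-linear for the multiplication on the right, and
  \<open>\<Phi> (\<iota>E u) = \<Phi> u j\<close> because \<open>\<iota>E\<close> squares to \<open>-1\<close>. It is injective on the fibre over \<open>x\<close> if and only if the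
  \<open>2m\<close> functionals \<open>a r\<close> and \<open>star (a r)\<close>, with \<open>star a\<close> the complex conjugate of \<open>a \<circ> \<iota>E\<close>, have no common
  zero other than \<open>0\<close> there (\<open>equivariant_monomorphism_of_separating_family\<close>). This condition on \<open>x\<close> is
  open (\<open>separates_open\<close>) and invariant under \<open>\<iota>J\<close> (\<open>separates_\<iota>J\<close>). The task is to satisfy it at every
  point of \<open>J\<close>.

  Over a fixed point, \<open>star\<close> is a quaternionic structure on the dual of the fibre, and a quaternionic basis
  of this dual consists of \<open>l \<le> m\<close> functionals \<open>a r\<close> that satisfy the condition
  (\<open>fixed_fibre_quaternionic_coordinates\<close>). The fixed points are isolated and hence finite in number,
  so one family serves them all, and by openness it serves a neighbourhood of them.

  Over a small closed set \<open>T\<close> that is disjoint from \<open>\<iota>J T\<close>, the functionals \<open>a r\<close> and \<open>star (a r)\<close> can be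
  changed independently of each other. In local coordinates they are then an arbitrary continuous matrix
  function with \<open>2m\<close> rows and \<open>2l\<close> columns. The matrices that are not injective have real codimension
  \<open>2 (2m - 2l + 1) = 4 (m - l) + 2\<close>, and this exceeds \<open>k\<close> because \<open>m - l\<close> is the integral part of
  \<open>(k + 2) / 4\<close>. So a small perturbation makes the matrix injective on a given part of \<open>T\<close>, and if it is
  small enough, injectivity is kept where it held before (\<open>general_position_step\<close>). Finitely many such
  steps exhaust \<open>J\<close> (\<open>separating_family_exists\<close>).

  General position is obtained by counting. The matrix function is first approximated by one that is
  Lipschitz in the \<open>k\<close> coordinates of a chart (\<open>chart_lipschitz_approximation\<close>). A constant matrix is then
  added column by column: the next column has to avoid a Lipschitz image in complex \<open>2m\<close>-space of a bounded
  set with fewer than \<open>4m\<close> real coordinates, and such an image cannot come close to all points of a fine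
  grid (\<open>lipschitz_image_avoids_ball\<close>, \<open>generic_translate_uniformly_injective\<close>).
\<close>

section \<open>General position by counting\<close>

text \<open>
  Pigeonhole. A grid of mesh \<open>\<sigma>\<close> in the ball has of the order of \<open>\<sigma>^(-2p)\<close> points. The set \<open>T\<close>, described by
  \<open>d\<close> bounded real coordinates \<open>\<kappa>\<close>, is cut into cells of a size comparable to \<open>\<sigma>\<close>; there are only of the
  order of \<open>\<sigma>^(-d)\<close> of them, and the image of a cell is so small that it comes near at most one grid point.
  As \<open>d < 2p\<close>, some grid point is far from the image.
\<close>
lemma lipschitz_image_avoids_ball:
  fixes T :: "'p set" and \<kappa> :: "'p \<Rightarrow> nat \<Rightarrow> real" and q :: "'p \<Rightarrow> nat \<Rightarrow> complex"
  assumes bd: "\<And>y i. y \<in> T \<Longrightarrow> i < d \<Longrightarrow> \<bar>\<kappa> y i\<bar> \<le> R"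
    and lip: "\<And>y z r \<delta>. y \<in> T \<Longrightarrow> z \<in> T \<Longrightarrow> r < p \<Longrightarrow> 0 \<le> \<delta> \<Longrightarrow>
               (\<And>i. i < d \<Longrightarrow> \<bar>\<kappa> y i - \<kappa> z i\<bar> \<le> \<delta>) \<Longrightarrow> cmod (q y r - q z r) \<le> L * \<delta>"
    and dp: "d < 2 * p" and \<epsilon>: "\<epsilon> > 0"
  shows "\<exists>b \<eta>. \<eta> > 0 \<and> (\<forall>r. cmod (b r) \<le> \<epsilon>) \<and> (\<forall>y\<in>T. \<exists>r<p. \<eta> \<le> cmod (q y r - b r))"
proof -
  obtain R0 :: nat where R0: "1 \<le> R0" "R \<le> real R0"
    by (metis nat_le_linear of_nat_le_iff order_trans real_arch_simple)
  \<comment> \<open>A cell has an image of diameter at most \<sigma> / 4; with a distance below \<sigma> / 4 at both ends this is less than \<sigma>.\<close>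
  obtain K :: nat where K: "1 \<le> K" "8 * L / \<epsilon> \<le> real K"
    by (metis nat_le_linear of_nat_le_iff order_trans real_arch_simple)
  \<comment> \<open>The number of grid points per real coordinate. There are at most (3 R0 K)^d N^d cells and N^(2p) grid points.\<close>
  define N where "N = (3 * R0 * K) ^ d + 1"
  define M where "M = K * N"
  define \<sigma> where "\<sigma> = \<epsilon> / (2 * real N)"
  define val where "val st = Complex (\<sigma> * real (fst st)) (\<sigma> * real (snd st))" for st :: "nat \<times> nat"
  define lab where "lab y = (\<lambda>i\<in>{..<d}. \<lfloor>\<kappa> y i * real M\<rfloor>)" for y
  have N1: "1 \<le> N" and M1: "1 \<le> M" using K by (auto simp: N_def M_def)
  have \<sigma>: "\<sigma> > 0" using N1 \<epsilon> by (simp add: \<sigma>_def)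
  have LM: "L * (1 / real M) \<le> \<sigma> / 4"
  proof -
    have "8 * L \<le> \<epsilon> * real K" using K(2) \<epsilon> by (simp add: field_simps)
    then show ?thesis using N1 K(1) by (simp add: \<sigma>_def M_def field_simps)
  qed
  have sep: "cmod (val st - val st') \<ge> \<sigma>" if "st \<noteq> st'" for st st'
  proof -
    have int: "\<bar>real m - real n\<bar> \<ge> 1" if "m \<noteq> n" for m n :: nat
      using that by linarith
    have "fst st \<noteq> fst st' \<or> snd st \<noteq> snd st'" using that by (simp add: prod_eq_iff)
    then show ?thesis
    proof
      assume "fst st \<noteq> fst st'"
      then have "\<sigma> * 1 \<le> \<sigma> * \<bar>real (fst st) - real (fst st')\<bar>"
        using int \<sigma> by (intro mult_left_mono) auto
      also have "\<dots> = \<bar>Re (val st - val st')\<bar>"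
        using \<sigma> by (simp add: val_def abs_mult flip: right_diff_distrib)
      also have "\<dots> \<le> cmod (val st - val st')" by (rule abs_Re_le_cmod)
      finally show ?thesis by simp
    next
      assume "snd st \<noteq> snd st'"
      then have "\<sigma> * 1 \<le> \<sigma> * \<bar>real (snd st) - real (snd st')\<bar>"
        using int \<sigma> by (intro mult_left_mono) auto
      also have "\<dots> = \<bar>Im (val st - val st')\<bar>"
        using \<sigma> by (simp add: val_def abs_mult flip: right_diff_distrib)
      also have "\<dots> \<le> cmod (val st - val st')" by (rule abs_Im_le_cmod)
      finally show ?thesis by simp
    qed
  qed
  define Gr where "Gr = PiE {..<p} (\<lambda>_. {..<N} \<times> {..<N})"
  define Lb where "Lb = PiE {..<d} (\<lambda>_. {- int (R0 * M) .. int (R0 * M)})"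
  have finL: "finite Lb" unfolding Lb_def by (intro finite_PiE) auto
  have labT: "lab y \<in> Lb" if "y \<in> T" for y
  proof -
    have "\<lfloor>\<kappa> y i * real M\<rfloor> \<in> {- int (R0 * M) .. int (R0 * M)}" if "i < d" for i
    proof -
      have "\<bar>\<kappa> y i * real M\<bar> \<le> real R0 * real M"
        using bd[OF \<open>y \<in> T\<close> that] R0(2) by (auto simp: abs_mult intro!: mult_right_mono)
      then have "real_of_int (- int (R0 * M)) \<le> \<kappa> y i * real M"
        and "\<kappa> y i * real M \<le> real_of_int (int (R0 * M))" by auto
      then show ?thesis by (metis atLeastAtMost_iff floor_mono floor_of_int)
    qed
    then show ?thesis unfolding Lb_def lab_def by auto
  qed
  have "card Lb = (2 * (R0 * M) + 1) ^ d"
    unfolding Lb_def by (simp add: card_PiE nat_add_distrib nat_mult_distrib mult.commute)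
  also have "\<dots> \<le> (3 * (R0 * M)) ^ d"
    using R0(1) M1 by (intro power_mono) (auto simp: Suc_le_eq)
  also have "\<dots> = (3 * R0 * K) ^ d * N ^ d"
    by (simp add: M_def power_mult_distrib mult_ac)
  also have "\<dots> < N * N ^ d" using N1 by (simp add: N_def)
  also have "\<dots> = N ^ (d + 1)" by simp
  also have "\<dots> \<le> N ^ (2 * p)" using dp N1 by (intro power_increasing) auto
  also have "\<dots> = card Gr"
    unfolding Gr_def by (simp add: card_PiE power_mult power2_eq_square)
  finally have card: "card Lb < card Gr" .
  have "\<exists>g\<in>Gr. \<forall>y\<in>T. \<exists>r<p. \<sigma> / 4 \<le> cmod (q y r - val (g r))"
  proof (rule ccontr)
    assume "\<not> ?thesis"
    then have "\<forall>g\<in>Gr. \<exists>y\<in>T. \<forall>r<p. cmod (q y r - val (g r)) < \<sigma> / 4"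
      by (meson not_le)
    then obtain Y where Y: "\<And>g. g \<in> Gr \<Longrightarrow> Y g \<in> T"
      "\<And>g r. g \<in> Gr \<Longrightarrow> r < p \<Longrightarrow> cmod (q (Y g) r - val (g r)) < \<sigma> / 4"
      by metis
    have "\<not> inj_on (\<lambda>g. lab (Y g)) Gr"
    proof (rule pigeonhole)
      have "card ((\<lambda>g. lab (Y g)) ` Gr) \<le> card Lb"
        using labT Y(1) finL by (intro card_mono) auto
      then show "card ((\<lambda>g. lab (Y g)) ` Gr) < card Gr" using card by simp
    qed
    then obtain g g' where g: "g \<in> Gr" "g' \<in> Gr" "g \<noteq> g'" and eq: "lab (Y g) = lab (Y g')"
      by (auto simp: inj_on_def)
    obtain r where r: "r < p" "g r \<noteq> g' r"
      using g by (metis Gr_def PiE_ext lessThan_iff)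
    have "\<bar>\<kappa> (Y g) i - \<kappa> (Y g') i\<bar> \<le> 1 / real M" if "i < d" for i
    proof -
      have "\<lfloor>\<kappa> (Y g) i * real M\<rfloor> = \<lfloor>\<kappa> (Y g') i * real M\<rfloor>"
        using fun_cong[OF eq, of i] that by (simp add: lab_def)
      then have "\<bar>\<kappa> (Y g) i * real M - \<kappa> (Y g') i * real M\<bar> \<le> 1" by linarith
      then have "\<bar>\<kappa> (Y g) i - \<kappa> (Y g') i\<bar> * real M \<le> 1"
        by (simp add: abs_mult flip: left_diff_distrib)
      then show ?thesis using M1 by (simp add: field_simps)
    qed
    then have "cmod (q (Y g) r - q (Y g') r) \<le> L * (1 / real M)"
      using lip[of "Y g" "Y g'" r "1 / real M"] Y(1) g r(1) by auto
    moreover have "cmod (val (g r) - val (g' r)) \<le>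
        cmod (q (Y g) r - val (g r)) + cmod (q (Y g') r - val (g' r)) + cmod (q (Y g) r - q (Y g') r)"
    proof -
      define u where "u = val (g r) - q (Y g) r"
      define v where "v = q (Y g') r - val (g' r)"
      have "val (g r) - val (g' r) = u + v + (q (Y g) r - q (Y g') r)" by (simp add: u_def v_def)
      also have "cmod \<dots> \<le> cmod u + cmod v + cmod (q (Y g) r - q (Y g') r)"
        by (intro norm_triangle_le add_right_mono norm_triangle_ineq)
      finally show ?thesis by (simp add: u_def v_def norm_minus_commute)
    qed
    ultimately show False
      using Y(2)[OF g(1) r(1)] Y(2)[OF g(2) r(1)] LM sep[OF r(2)] \<sigma> by linarith
  qed
  then obtain g where g: "g \<in> Gr" "\<And>y. y \<in> T \<Longrightarrow> \<exists>r<p. \<sigma> / 4 \<le> cmod (q y r - val (g r))" by blast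
  show ?thesis
  proof (intro exI[of _ "\<lambda>r. if r < p then val (g r) else 0"] exI[of _ "\<sigma> / 4"] conjI allI ballI)
    show "cmod (if r < p then val (g r) else 0) \<le> \<epsilon>" for r
    proof (cases "r < p")
      case True
      then have st: "fst (g r) < N" "snd (g r) < N" using g(1) by (auto simp: Gr_def PiE_iff mem_Times_iff)
      have "cmod (val (g r)) \<le> \<bar>Re (val (g r))\<bar> + \<bar>Im (val (g r))\<bar>" by (rule cmod_le)
      also have "\<dots> \<le> \<sigma> * real N + \<sigma> * real N"
        unfolding val_def using st \<sigma> by (intro add_mono) (auto simp: abs_mult intro!: mult_left_mono)
      also have "\<dots> = \<epsilon>" using N1 by (simp add: \<sigma>_def)
      finally show ?thesis using True by simp
    qed (use \<epsilon> in auto)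
    show "\<exists>r<p. \<sigma> / 4 \<le> cmod (q y r - (if r < p then val (g r) else 0))" if "y \<in> T" for y
      using g(2)[OF that] by auto
  qed (use \<sigma> in auto)
qed

text \<open>
  The matrices with \<open>p\<close> rows and \<open>n\<close> columns that are not injective have real codimension \<open>2 (p - n + 1)\<close>, so
  a translate of a \<open>k\<close>-dimensional family avoids them if \<open>k\<close> is smaller. The columns of \<open>b\<close> are chosen one after
  the other. If the first \<open>n\<close> columns are injective with lower bound \<open>c\<close>, the next one fails only if it
  hits the value \<open>q (x, \<xi>)\<close> below for some \<open>x\<close> and \<open>\<xi>\<close>. The bound \<open>c\<close> confines the relevant \<open>\<xi>\<close> to a bounded
  set, so the values to be avoided are a Lipschitz image of a bounded set with \<open>k + 2n\<close> real coordinates.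
\<close>
lemma generic_translate_uniformly_injective:
  fixes T :: "'p set" and \<phi> :: "'p \<Rightarrow> nat \<Rightarrow> real" and g :: "nat \<Rightarrow> nat \<Rightarrow> 'p \<Rightarrow> complex"
  assumes "\<And>x i. x \<in> T \<Longrightarrow> i < k \<Longrightarrow> \<bar>\<phi> x i\<bar> \<le> R"
    and "\<And>x r j. x \<in> T \<Longrightarrow> r < p \<Longrightarrow> j < n \<Longrightarrow> cmod (g r j x) \<le> G"
    and "\<And>x y r j \<delta>. x \<in> T \<Longrightarrow> y \<in> T \<Longrightarrow> r < p \<Longrightarrow> j < n \<Longrightarrow> 0 \<le> \<delta> \<Longrightarrow>
           (\<And>i. i < k \<Longrightarrow> \<bar>\<phi> x i - \<phi> y i\<bar> \<le> \<delta>) \<Longrightarrow> cmod (g r j x - g r j y) \<le> L * \<delta>"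
    and "k + 2 * n < 2 * p + 2" and \<epsilon>: "\<epsilon> > 0"
  shows "\<exists>b c. c > 0 \<and> (\<forall>r j. cmod (b r j) \<le> \<epsilon>) \<and>
           (\<forall>x\<in>T. \<forall>\<xi> s. (\<forall>r<p. cmod (\<Sum>j<n. (g r j x + b r j) * \<xi> j) \<le> s) \<longrightarrow>
              (\<forall>j<n. c * cmod (\<xi> j) \<le> s))"
  using assms(1-4)
proof (induction n)
  case 0
  show ?case
    by (rule exI[of _ "\<lambda>_ _. 0"], rule exI[of _ "1::real"]) (use \<epsilon> in auto)
next
  case (Suc n)
  note bd = Suc.prems(1) and gb = Suc.prems(2) and lip = Suc.prems(3) and dim = Suc.prems(4)
  have "\<exists>b c. c > 0 \<and> (\<forall>r j. cmod (b r j) \<le> \<epsilon>) \<and>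
         (\<forall>x\<in>T. \<forall>\<xi> s. (\<forall>r<p. cmod (\<Sum>j<n. (g r j x + b r j) * \<xi> j) \<le> s) \<longrightarrow>
            (\<forall>j<n. c * cmod (\<xi> j) \<le> s))"
  proof (rule Suc.IH)
    show "\<And>x r j. x \<in> T \<Longrightarrow> r < p \<Longrightarrow> j < n \<Longrightarrow> cmod (g r j x) \<le> G" by (rule gb) auto
    show "cmod (g r j x - g r j y) \<le> L * \<delta>"
      if "x \<in> T" "y \<in> T" "r < p" "j < n" "0 \<le> \<delta>" "\<And>i. i < k \<Longrightarrow> \<bar>\<phi> x i - \<phi> y i\<bar> \<le> \<delta>"
      for x y r j \<delta>
      by (rule lip[OF that(1-3) _ that(5)]) (use that(4) in simp, rule that(6))
    show "k + 2 * n < 2 * p + 2" using dim by simp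
  qed (rule bd)
  then obtain b c where bc: "c > 0" "\<forall>r j. cmod (b r j) \<le> \<epsilon>"
    "\<forall>x\<in>T. \<forall>\<xi> s. (\<forall>r<p. cmod (\<Sum>j<n. (g r j x + b r j) * \<xi> j) \<le> s) \<longrightarrow>
            (\<forall>j<n. c * cmod (\<xi> j) \<le> s)"
    by (elim exE conjE)
  note c = bc(1)
  have b: "cmod (b r j) \<le> \<epsilon>" for r j using bc(2) by simp
  have inj: "c * cmod (\<xi> j) \<le> s" if "x \<in> T"
      "\<And>r. r < p \<Longrightarrow> cmod (\<Sum>j<n. (g r j x + b r j) * \<xi> j) \<le> s" "j < n" for x \<xi> s j
    using bc(3)[rule_format, OF that(1) _ that(3)] that(2) by simp
  have p0: "0 < p" using dim by simp
  define H where "H = \<bar>G\<bar> + \<epsilon>"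
  have H: "H > 0" using \<epsilon> by (simp add: H_def)
  have Hb: "cmod (g r j x + v) \<le> H" if "x \<in> T" "r < p" "j < Suc n" "cmod v \<le> \<epsilon>" for x r j v
    using gb[OF that(1-3)] that(4) norm_triangle_ineq[of "g r j x" v] by (simp add: H_def)
  \<comment> \<open>If some entry of \<xi> exceeds Q times the last one, the first n columns dominate the last column.\<close>
  define Q where "Q = max 1 (2 * H / c)"
  have Q: "Q \<ge> 1" "2 * H / c \<le> Q" by (auto simp: Q_def)
  define P where "P = {(x, \<xi>). x \<in> T \<and> (\<forall>j<n. cmod (\<xi> j) \<le> Q)}"
  define \<kappa> where "\<kappa> = (\<lambda>(x, \<xi>::nat \<Rightarrow> complex) i. if i < k then \<phi> x i
                        else if i < k + n then Re (\<xi> (i - k)) else Im (\<xi> (i - k - n)))"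
  define q where "q = (\<lambda>(x, \<xi>::nat \<Rightarrow> complex) r. - g r n x - (\<Sum>j<n. (g r j x + b r j) * \<xi> j))"
  have \<kappa>: "\<bar>\<kappa> y i\<bar> \<le> max R Q" if "y \<in> P" "i < k + 2 * n" for y i
  proof -
    obtain x \<xi> where "y = (x, \<xi>)" by (cases y)
    then have y: "y = (x, \<xi>)" "x \<in> T" "\<And>j. j < n \<Longrightarrow> cmod (\<xi> j) \<le> Q"
      using that(1) by (simp_all add: P_def)
    consider "i < k" | "k \<le> i" "i < k + n" | "k + n \<le> i" by linarith
    then show ?thesis
    proof cases
      case 1 then show ?thesis using bd[OF y(2) 1] by (simp add: \<kappa>_def y)
    next
      case 2
      then have "cmod (\<xi> (i - k)) \<le> Q" by (intro y(3)) auto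
      then have "\<bar>Re (\<xi> (i - k))\<bar> \<le> Q" using abs_Re_le_cmod order_trans by blast
      then show ?thesis using 2 by (simp add: \<kappa>_def y)
    next
      case 3
      then have "cmod (\<xi> (i - k - n)) \<le> Q" using that(2) by (intro y(3)) auto
      then have "\<bar>Im (\<xi> (i - k - n))\<bar> \<le> Q" using abs_Im_le_cmod order_trans by blast
      then show ?thesis using 3 by (simp add: \<kappa>_def y)
    qed
  qed
  have qlip: "cmod (q y r - q z r) \<le> (L + real n * (L * Q + H * 2)) * \<delta>"
    if yz: "y \<in> P" "z \<in> P" and r: "r < p" and \<delta>: "0 \<le> \<delta>"
      and close: "\<And>i. i < k + 2 * n \<Longrightarrow> \<bar>\<kappa> y i - \<kappa> z i\<bar> \<le> \<delta>" for y z r \<delta>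
  proof -
    obtain x \<xi> where "y = (x, \<xi>)" by (cases y)
    then have y: "y = (x, \<xi>)" "x \<in> T" "\<And>j. j < n \<Longrightarrow> cmod (\<xi> j) \<le> Q"
      using yz(1) by (simp_all add: P_def)
    obtain x' \<xi>' where "z = (x', \<xi>')" by (cases z)
    then have z: "z = (x', \<xi>')" "x' \<in> T" "\<And>j. j < n \<Longrightarrow> cmod (\<xi>' j) \<le> Q"
      using yz(2) by (simp_all add: P_def)
    have "\<bar>\<phi> x i - \<phi> x' i\<bar> \<le> \<delta>" if "i < k" for i
      using close[of i] that by (simp add: \<kappa>_def y z)
    then have gl: "cmod (g r j x - g r j x') \<le> L * \<delta>" if "j < Suc n" for j
      using lip[OF y(2) z(2) r that \<delta>] by blast
    have xl: "cmod (\<xi> j - \<xi>' j) \<le> 2 * \<delta>" if "j < n" for j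
    proof -
      have "\<bar>Re (\<xi> j - \<xi>' j)\<bar> \<le> \<delta>" using close[of "k + j"] that by (simp add: \<kappa>_def y z)
      moreover have "\<bar>Im (\<xi> j - \<xi>' j)\<bar> \<le> \<delta>"
        using close[of "k + n + j"] that by (simp add: \<kappa>_def y z)
      ultimately show ?thesis using cmod_le[of "\<xi> j - \<xi>' j"] by linarith
    qed
    define u where "u j = (g r j x - g r j x') * \<xi> j + (g r j x' + b r j) * (\<xi> j - \<xi>' j)" for j
    have u: "cmod (u j) \<le> (L * \<delta>) * Q + H * (2 * \<delta>)" if "j < n" for j
    proof -
      have j: "j < Suc n" using that by simp
      have "cmod ((g r j x - g r j x') * \<xi> j) \<le> (L * \<delta>) * Q"
        unfolding norm_mult
        by (rule mult_mono[OF gl[OF j] y(3)[OF that] order_trans[OF norm_ge_zero gl[OF j]] norm_ge_zero])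
      moreover have "cmod ((g r j x' + b r j) * (\<xi> j - \<xi>' j)) \<le> H * (2 * \<delta>)"
        unfolding norm_mult using H by (intro mult_mono Hb[OF z(2) r j b] xl[OF that]) auto
      ultimately show ?thesis unfolding u_def by (rule norm_triangle_le[OF add_mono])
    qed
    have u_eq: "u j = (g r j x + b r j) * \<xi> j - (g r j x' + b r j) * \<xi>' j" for j
      by (simp add: u_def algebra_simps)
    have "q y r - q z r = - (g r n x - g r n x') - sum u {..<n}"
      by (simp add: q_def y z u_eq sum_subtractf)
    then have "cmod (q y r - q z r) \<le> cmod (- (g r n x - g r n x')) + cmod (sum u {..<n})"
      using norm_triangle_ineq4 by metis
    also have "cmod (- (g r n x - g r n x')) \<le> L * \<delta>"
      using gl[of n] by (simp add: norm_minus_commute)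
    also have "cmod (sum u {..<n}) \<le> (\<Sum>j<n. (L * \<delta>) * Q + H * (2 * \<delta>))"
      by (rule sum_norm_le) (use u in simp)
    finally have "cmod (q y r - q z r) \<le> L * \<delta> + (\<Sum>j<n. (L * \<delta>) * Q + H * (2 * \<delta>))" by simp
    also have "\<dots> = (L + real n * (L * Q + H * 2)) * \<delta>" by (simp add: algebra_simps)
    finally show ?thesis .
  qed
  have "k + 2 * n < 2 * p" using dim by simp
  note dim' = this
  have "\<exists>v \<eta>. \<eta> > 0 \<and> (\<forall>r. cmod (v r) \<le> \<epsilon>) \<and> (\<forall>y\<in>P. \<exists>r<p. \<eta> \<le> cmod (q y r - v r))"
    by (rule lipschitz_image_avoids_ball[where d = "k + 2 * n" and \<kappa> = \<kappa> and R = "max R Q"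
          and L = "L + real n * (L * Q + H * 2)"], fact \<kappa>, fact qlip, fact dim', fact \<epsilon>)
  then obtain v \<eta> where \<eta>: "\<eta> > 0" and v: "\<forall>r. cmod (v r) \<le> \<epsilon>"
    and avoid: "\<forall>y\<in>P. \<exists>r<p. \<eta> \<le> cmod (q y r - v r)"
    by (elim exE conjE)
  define b' where "b' r j = (if j = n then v r else b r j)" for r j
  define c' where "c' = min (min (c / 2) H) (min (\<eta> / Q) \<eta>)"
  have c': "c' > 0" "c' \<le> c / 2" "c' \<le> H" "c' \<le> \<eta> / Q" "c' \<le> \<eta>"
    unfolding c'_def using c H \<eta> Q(1) divide_pos_pos[of \<eta> Q] by linarith+
  have "c' * cmod (\<xi> j) \<le> s"
    if x: "x \<in> T" and s: "\<And>r. r < p \<Longrightarrow> cmod (\<Sum>j<Suc n. (g r j x + b' r j) * \<xi> j) \<le> s" and j: "j < Suc n"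
    for x \<xi> s j
  proof -
    have s': "cmod ((\<Sum>j<n. (g r j x + b r j) * \<xi> j) + (g r n x + v r) * \<xi> n) \<le> s" if "r < p" for r
      using s[OF that] by (simp add: b'_def)
    have s0: "0 \<le> s" using s'[OF p0] norm_ge_zero order_trans by blast
    have fin: "c' * t \<le> s" if "e * t \<le> s" "c' \<le> e" "0 \<le> t" for e t :: real
      using mult_right_mono[OF that(2,3)] that(1) by linarith
    show ?thesis
    \<comment> \<open>Otherwise \<xi> divided by its last entry lies in the bounded parameter set, and \<eta> gives the bound.\<close>
    proof (cases "\<exists>i<n. Q * cmod (\<xi> n) < cmod (\<xi> i)")
      case True
      then obtain i where i: "i < n" "Q * cmod (\<xi> n) < cmod (\<xi> i)" by blast
      have "cmod (\<Sum>j<n. (g r j x + b r j) * \<xi> j) \<le> s + H * cmod (\<xi> n)" if r: "r < p" for r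
      proof -
        have "cmod ((g r n x + v r) * \<xi> n) \<le> H * cmod (\<xi> n)"
          unfolding norm_mult using Hb[OF x r _ v[rule_format]] by (intro mult_right_mono) auto
        then show ?thesis using s'[OF r]
          norm_triangle_ineq4[of "(\<Sum>j<n. (g r j x + b r j) * \<xi> j) + (g r n x + v r) * \<xi> n" "(g r n x + v r) * \<xi> n"]
          by simp
      qed
      then have cj: "c * cmod (\<xi> j) \<le> s + H * cmod (\<xi> n)" if "j < n" for j
        using inj[OF x _ that] by blast
      have "2 * H \<le> c * Q" using Q(2) c by (simp add: field_simps)
      then have "2 * H * cmod (\<xi> n) \<le> c * Q * cmod (\<xi> n)" by (intro mult_right_mono) auto
      also have "\<dots> \<le> c * cmod (\<xi> i)" using i(2) c by simp
      finally have *: "H * cmod (\<xi> n) \<le> s" using cj[OF i(1)] by linarith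
      show ?thesis
      proof (cases "j = n")
        case True then show ?thesis using fin[OF * c'(3)] by simp
      next
        case False
        then have "(c / 2) * cmod (\<xi> j) \<le> s" using cj[of j] j * by simp
        then show ?thesis using fin c'(2) norm_ge_zero by blast
      qed
    next
      case False
      then have le: "cmod (\<xi> i) \<le> Q * cmod (\<xi> n)" if "i < n" for i using that by force
      show ?thesis
      proof (cases "\<xi> n = 0")
        case True
        then have "\<xi> j = 0" using le[of j] j by (cases "j = n") auto
        then show ?thesis using s0 by simp
      next
        case nz: False
        have "(x, \<lambda>i. \<xi> i / \<xi> n) \<in> P"
          using x le nz by (auto simp: P_def norm_divide divide_simps)
        then obtain r where r: "r < p" "\<eta> \<le> cmod (q (x, \<lambda>i. \<xi> i / \<xi> n) r - v r)"
          using avoid by blast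
        have sum: "(\<Sum>j<n. (g r j x + b r j) * (\<xi> j / \<xi> n)) * \<xi> n = (\<Sum>j<n. (g r j x + b r j) * \<xi> j)"
          unfolding sum_distrib_right mult.assoc using nz by simp
        have "(q (x, \<lambda>i. \<xi> i / \<xi> n) r - v r) * \<xi> n =
            - ((\<Sum>j<n. (g r j x + b r j) * (\<xi> j / \<xi> n)) * \<xi> n + (g r n x + v r) * \<xi> n)"
          unfolding q_def prod.case left_diff_distrib distrib_right minus_add_distrib by simp
        then have eq: "(q (x, \<lambda>i. \<xi> i / \<xi> n) r - v r) * \<xi> n =
            - ((\<Sum>j<n. (g r j x + b r j) * \<xi> j) + (g r n x + v r) * \<xi> n)"
          unfolding sum .
        have "cmod ((q (x, \<lambda>i. \<xi> i / \<xi> n) r - v r) * \<xi> n) \<le> s"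
          unfolding eq norm_minus_cancel by (rule s'[OF r(1)])
        then have "cmod (q (x, \<lambda>i. \<xi> i / \<xi> n) r - v r) * cmod (\<xi> n) \<le> s"
          unfolding norm_mult .
        then have *: "\<eta> * cmod (\<xi> n) \<le> s"
          using mult_right_mono[OF r(2) norm_ge_zero[of "\<xi> n"]] by linarith
        show ?thesis
        proof (cases "j = n")
          case True then show ?thesis using fin[OF * c'(5)] by simp
        next
          case False
          then have "(\<eta> / Q) * cmod (\<xi> j) \<le> (\<eta> / Q) * (Q * cmod (\<xi> n))"
            using le[of j] j \<eta> Q by (intro mult_left_mono) auto
          also have "\<dots> \<le> s" using * Q(1) by simp
          finally show ?thesis using fin c'(4) norm_ge_zero by blast
        qed
      qed
    qed
  qed
  note lower_bound = this
  have "cmod (b' r j) \<le> \<epsilon>" for r j using b v by (simp add: b'_def)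
  with c'(1) lower_bound show ?case
    by (intro exI[of _ b'] exI[of _ c'] conjI allI ballI impI) simp_all
qed

section \<open>Lipschitz approximation in charts and compactness\<close>

lemma continuous_map_mult_complex:
  fixes f g :: "'a \<Rightarrow> complex"
  assumes "continuous_map X euclidean f" "continuous_map X euclidean g"
  shows "continuous_map X euclidean (\<lambda>x. f x * g x)"
  using assms by (simp add: continuous_map_atin tendsto_mult)

lemma continuous_map_cnj:
  "continuous_map X euclidean f \<Longrightarrow> continuous_map X euclidean (\<lambda>x. cnj (f x))"
  by (simp add: continuous_map_atin tendsto_cnj)

lemma continuous_map_complex_of_real:
  "continuous_map X euclideanreal f \<Longrightarrow> continuous_map X euclidean (\<lambda>x. complex_of_real (f x))"
  by (simp add: continuous_map_atin tendsto_of_real)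

text \<open>
  The Lipschitz condition for the pseudometric that is the maximum of the \<open>\<bar>\<phi> x i - \<phi> y i\<bar>\<close> with \<open>i < k\<close>. Upper
  bounds \<open>\<delta>\<close> stand for the maximum, so that \<open>k = 0\<close> is included.
\<close>
definition lipschitz_in_coords :: "nat \<Rightarrow> ('p \<Rightarrow> nat \<Rightarrow> real) \<Rightarrow> 'p set \<Rightarrow> ('p \<Rightarrow> 'v::real_normed_vector) \<Rightarrow> bool" where
  "lipschitz_in_coords k \<phi> T g \<longleftrightarrow> (\<exists>L\<ge>0. \<forall>x\<in>T. \<forall>y\<in>T. \<forall>\<delta>\<ge>0.
     (\<forall>i<k. \<bar>\<phi> x i - \<phi> y i\<bar> \<le> \<delta>) \<longrightarrow> norm (g x - g y) \<le> L * \<delta>)"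

text \<open>
  The Stone-Weierstrass theorem: on a compact set, Lipschitz functions form an algebra, and this algebra contains
  the coordinate functions, of which the first \<open>k\<close> separate the points of \<open>S\<close>.
\<close>
lemma lipschitz_dense_real:
  fixes S :: "(nat \<Rightarrow> real) set" and f :: "(nat \<Rightarrow> real) \<Rightarrow> real"
  assumes S: "compact S" "S \<subseteq> {x. \<forall>i\<ge>k. x i = 0}" and f: "continuous_on S f" and e: "e > 0"
  shows "\<exists>g. (continuous_on S g \<and> lipschitz_in_coords k (\<lambda>x. x) S g) \<and> (\<forall>x\<in>S. \<bar>f x - g x\<bar> < e)"
proof (rule Stone_Weierstrass_HOL[OF S(1) _ _ _ _ _ f e])
  show "continuous_on S (\<lambda>x. c) \<and> lipschitz_in_coords k (\<lambda>x. x) S (\<lambda>x. c)" for c :: real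
    by (auto simp: lipschitz_in_coords_def intro!: exI[of _ 0])
  show "continuous_on S g" if "continuous_on S g \<and> lipschitz_in_coords k (\<lambda>x. x) S g" for g :: "(nat \<Rightarrow> real) \<Rightarrow> real"
    using that by blast
next
  fix g h :: "(nat \<Rightarrow> real) \<Rightarrow> real"
  assume A: "(continuous_on S g \<and> lipschitz_in_coords k (\<lambda>x. x) S g) \<and> (continuous_on S h \<and> lipschitz_in_coords k (\<lambda>x. x) S h)"
  obtain L where L: "L \<ge> 0" "\<And>x y \<delta>. x \<in> S \<Longrightarrow> y \<in> S \<Longrightarrow> \<delta> \<ge> 0 \<Longrightarrow> \<forall>i<k. \<bar>x i - y i\<bar> \<le> \<delta> \<Longrightarrow> \<bar>g x - g y\<bar> \<le> L * \<delta>"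
    using A unfolding lipschitz_in_coords_def real_norm_def by (meson less_imp_le)
  obtain M where M: "M \<ge> 0" "\<And>x y \<delta>. x \<in> S \<Longrightarrow> y \<in> S \<Longrightarrow> \<delta> \<ge> 0 \<Longrightarrow> \<forall>i<k. \<bar>x i - y i\<bar> \<le> \<delta> \<Longrightarrow> \<bar>h x - h y\<bar> \<le> M * \<delta>"
    using A unfolding lipschitz_in_coords_def real_norm_def by (meson less_imp_le)
  have "\<bar>(g x + h x) - (g y + h y)\<bar> \<le> (L + M) * \<delta>"
    if "x \<in> S" "y \<in> S" "\<delta> \<ge> 0" "\<forall>i<k. \<bar>x i - y i\<bar> \<le> \<delta>" for x y \<delta>
    using L(2)[OF that] M(2)[OF that] by (simp add: distrib_right)
  then have "lipschitz_in_coords k (\<lambda>x. x) S (\<lambda>x. g x + h x)"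
    unfolding lipschitz_in_coords_def real_norm_def using L(1) M(1) by (intro exI[of _ "L + M"]) auto
  then show "continuous_on S (\<lambda>x. g x + h x) \<and> lipschitz_in_coords k (\<lambda>x. x) S (\<lambda>x. g x + h x)"
    using A by (simp add: continuous_on_add)
  have bounded: "\<exists>B\<ge>0. \<forall>x\<in>S. \<bar>u x\<bar> \<le> B" if "continuous_on S u" for u :: "(nat \<Rightarrow> real) \<Rightarrow> real"
  proof -
    have "bounded (u ` S)" using compact_continuous_image[OF that S(1)] by (rule compact_imp_bounded)
    then obtain B where "\<forall>x\<in>S. \<bar>u x\<bar> \<le> B" by (auto simp: bounded_iff)
    then show ?thesis by (intro exI[of _ "max 0 B"]) auto
  qed
  obtain B where B: "B \<ge> 0" "\<And>x. x \<in> S \<Longrightarrow> \<bar>g x\<bar> \<le> B" using A bounded by blast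
  obtain C where C: "C \<ge> 0" "\<And>x. x \<in> S \<Longrightarrow> \<bar>h x\<bar> \<le> C" using A bounded by blast
  have "\<bar>g x * h x - g y * h y\<bar> \<le> (L * C + B * M) * \<delta>"
    if "x \<in> S" "y \<in> S" "\<delta> \<ge> 0" "\<forall>i<k. \<bar>x i - y i\<bar> \<le> \<delta>" for x y \<delta>
  proof -
    have "g x * h x - g y * h y = (g x - g y) * h x + g y * (h x - h y)" by (simp add: algebra_simps)
    also have "\<bar>\<dots>\<bar> \<le> \<bar>g x - g y\<bar> * \<bar>h x\<bar> + \<bar>g y\<bar> * \<bar>h x - h y\<bar>"
      by (rule order_trans[OF abs_triangle_ineq]) (simp add: abs_mult)
    also have "\<dots> \<le> (L * \<delta>) * C + B * (M * \<delta>)"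
      using L(2)[OF that] M(2)[OF that] B(2)[OF that(2)] C(2)[OF that(1)] L(1) M(1) that(3) B(1) C(1)
      by (intro add_mono mult_mono) auto
    finally show ?thesis by (simp add: algebra_simps)
  qed
  then have "lipschitz_in_coords k (\<lambda>x. x) S (\<lambda>x. g x * h x)"
    unfolding lipschitz_in_coords_def real_norm_def using L(1) M(1) B(1) C(1)
    by (intro exI[of _ "L * C + B * M"]) auto
  then show "continuous_on S (\<lambda>x. g x * h x) \<and> lipschitz_in_coords k (\<lambda>x. x) S (\<lambda>x. g x * h x)"
    using A by (simp add: continuous_on_mult)
next
  fix x y assume xy: "x \<in> S \<and> y \<in> S \<and> x \<noteq> y"
  then obtain i where i: "x i \<noteq> y i" by auto
  then have "i < k" using xy S(2) by (metis (mono_tags, lifting) mem_Collect_eq not_le subsetD)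
  then have "lipschitz_in_coords k (\<lambda>x. x) S (\<lambda>x. x i)"
    unfolding lipschitz_in_coords_def by (intro exI[of _ 1]) auto
  moreover have "continuous_on S (\<lambda>x. x i)"
    by (rule continuous_on_subset[OF continuous_on_product_coordinates subset_UNIV])
  ultimately have "(continuous_on S (\<lambda>z. z i) \<and> lipschitz_in_coords k (\<lambda>x. x) S (\<lambda>z. z i)) \<and> x i \<noteq> y i"
    using i by simp
  then show "\<exists>f::_ \<Rightarrow> real. (continuous_on S f \<and> lipschitz_in_coords k (\<lambda>x. x) S f) \<and> f x \<noteq> f y"
    by - (rule exI[of _ "\<lambda>z. z i"])
qed

lemma compactin_Euclidean_space_imp_compact:
  assumes "compactin (Euclidean_space k) S"
  shows "compact S" "S \<subseteq> {x. \<forall>i\<ge>k. x i = 0}"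
  using assms unfolding Euclidean_space_def euclidean_product_topology
  by (simp_all add: compactin_subtopology)

text \<open>
  The chart carries \<open>T\<close> to a compact set in \<open>R^k\<close>, where real and imaginary part can be approximated
  separately.
\<close>
lemma chart_lipschitz_approximation:
  fixes \<phi> :: "'a \<Rightarrow> nat \<Rightarrow> real" and f :: "'a \<Rightarrow> complex"
  assumes \<phi>: "homeomorphic_map (subtopology J U) (subtopology (Euclidean_space k) (\<phi> ` U)) \<phi>"
    and T: "compactin J T" "T \<subseteq> U"
    and f: "continuous_map (subtopology J T) euclidean f" and e: "e > 0"
  obtains g where "continuous_map (subtopology J T) euclidean g" "lipschitz_in_coords k \<phi> T g"
    "\<And>x. x \<in> T \<Longrightarrow> cmod (f x - g x) < e"
proof -
  have Ttop: "T \<subseteq> topspace J" using T(1) by (simp add: compactin_subset_topspace)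
  have c\<phi>: "continuous_map (subtopology J T) (Euclidean_space k) \<phi>"
    using homeomorphic_imp_continuous_map[OF \<phi>] T(2)
    by (meson continuous_map_from_subtopology_mono continuous_map_in_subtopology)
  have cT: "compactin (Euclidean_space k) (\<phi> ` T)"
    using image_compactin[OF _ c\<phi>] T(1) by (simp add: compactin_subtopology)
  note S = compactin_Euclidean_space_imp_compact[OF cT]
  obtain \<psi> where \<psi>: "homeomorphic_maps (subtopology J U) (subtopology (Euclidean_space k) (\<phi> ` U)) \<phi> \<psi>"
    using \<phi> homeomorphic_map_maps by blast
  have inv: "\<psi> (\<phi> x) = x" if "x \<in> T" for x
    using \<psi> that T(2) Ttop by (auto simp: homeomorphic_maps_def)
  have "continuous_map (subtopology (Euclidean_space k) (\<phi> ` T)) J \<psi>"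
    using \<psi> T(2) unfolding homeomorphic_maps_def
    by (meson continuous_map_from_subtopology_mono continuous_map_in_subtopology image_mono)
  moreover have top: "subtopology (Euclidean_space k) (\<phi> ` T) = top_of_set (\<phi> ` T)"
    using S(2) by (simp add: Euclidean_space_def euclidean_product_topology subtopology_subtopology inf_absorb2)
  ultimately have c\<psi>: "continuous_map (top_of_set (\<phi> ` T)) (subtopology J T) \<psi>"
    using inv by (auto simp: continuous_map_in_subtopology)
  have "continuous_map (top_of_set (\<phi> ` T)) euclidean (f \<circ> \<psi>)"
    using c\<psi> f by (rule continuous_map_compose)
  then have cont: "continuous_on (\<phi> ` T) (\<lambda>x. f (\<psi> x))" by (simp add: comp_def)
  obtain p where p: "continuous_on (\<phi> ` T) p" "lipschitz_in_coords k (\<lambda>x. x) (\<phi> ` T) p"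
      "\<And>x. x \<in> \<phi> ` T \<Longrightarrow> \<bar>Re (f (\<psi> x)) - p x\<bar> < e / 2"
    using lipschitz_dense_real[OF S continuous_on_Re[OF cont], of "e / 2"] e by auto
  obtain q where q: "continuous_on (\<phi> ` T) q" "lipschitz_in_coords k (\<lambda>x. x) (\<phi> ` T) q"
      "\<And>x. x \<in> \<phi> ` T \<Longrightarrow> \<bar>Im (f (\<psi> x)) - q x\<bar> < e / 2"
    using lipschitz_dense_real[OF S continuous_on_Im[OF cont], of "e / 2"] e by auto
  have c\<phi>': "continuous_map (subtopology J T) (top_of_set (\<phi> ` T)) \<phi>"
    unfolding top[symmetric] by (rule continuous_map_into_subtopology[OF c\<phi>]) auto
  define g where "g x = Complex (p (\<phi> x)) (q (\<phi> x))" for x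
  show ?thesis
  proof
    have "continuous_on (\<phi> ` T) (\<lambda>y. complex_of_real (p y) + \<i> * complex_of_real (q y))"
      using p(1) q(1) by (intro continuous_intros)
    then have "continuous_map (top_of_set (\<phi> ` T)) euclidean (\<lambda>y. complex_of_real (p y) + \<i> * complex_of_real (q y))"
      by simp
    from continuous_map_compose[OF c\<phi>' this] show "continuous_map (subtopology J T) euclidean g"
      by (simp add: comp_def g_def[abs_def] Complex_eq)
    obtain L where L: "L \<ge> 0" "\<And>x y \<delta>. x \<in> T \<Longrightarrow> y \<in> T \<Longrightarrow> \<delta> \<ge> 0 \<Longrightarrow> \<forall>i<k. \<bar>\<phi> x i - \<phi> y i\<bar> \<le> \<delta> \<Longrightarrow> \<bar>p (\<phi> x) - p (\<phi> y)\<bar> \<le> L * \<delta>"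
      using p(2) unfolding lipschitz_in_coords_def by auto
    obtain M where M: "M \<ge> 0" "\<And>x y \<delta>. x \<in> T \<Longrightarrow> y \<in> T \<Longrightarrow> \<delta> \<ge> 0 \<Longrightarrow> \<forall>i<k. \<bar>\<phi> x i - \<phi> y i\<bar> \<le> \<delta> \<Longrightarrow> \<bar>q (\<phi> x) - q (\<phi> y)\<bar> \<le> M * \<delta>"
      using q(2) unfolding lipschitz_in_coords_def by auto
    have "cmod (g x - g y) \<le> (L + M) * \<delta>"
      if "x \<in> T" "y \<in> T" "\<delta> \<ge> 0" "\<forall>i<k. \<bar>\<phi> x i - \<phi> y i\<bar> \<le> \<delta>" for x y \<delta>
      using L(2)[OF that] M(2)[OF that] cmod_le[of "g x - g y"] by (simp add: g_def distrib_right)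
    then show "lipschitz_in_coords k \<phi> T g"
      unfolding lipschitz_in_coords_def using L(1) M(1) by (intro exI[of _ "L + M"]) auto
    show "cmod (f x - g x) < e" if "x \<in> T" for x
      using p(3)[of "\<phi> x"] q(3)[of "\<phi> x"] that cmod_le[of "f x - g x"] by (simp add: g_def inv)
  qed
qed

lemma chart_coords_bounded:
  fixes \<phi> :: "'a \<Rightarrow> nat \<Rightarrow> real"
  assumes \<phi>: "homeomorphic_map (subtopology J U) (subtopology (Euclidean_space k) (\<phi> ` U)) \<phi>"
    and T: "compactin J T" "T \<subseteq> U"
  shows "\<exists>R. \<forall>x\<in>T. \<forall>i<k. \<bar>\<phi> x i\<bar> \<le> R"
proof -
  have c\<phi>: "continuous_map (subtopology J T) (Euclidean_space k) \<phi>"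
    using homeomorphic_imp_continuous_map[OF \<phi>] T(2)
    by (meson continuous_map_from_subtopology_mono continuous_map_in_subtopology)
  have cT: "compactin (Euclidean_space k) (\<phi> ` T)"
    using image_compactin[OF _ c\<phi>] T(1) by (simp add: compactin_subtopology)
  have "\<exists>R. \<forall>x\<in>T. \<bar>\<phi> x i\<bar> \<le> R" for i
  proof -
    have "continuous_on (\<phi> ` T) (\<lambda>y. y i)"
      by (rule continuous_on_subset[OF continuous_on_product_coordinates subset_UNIV])
    then have "bounded ((\<lambda>y. y i) ` \<phi> ` T)"
      using compactin_Euclidean_space_imp_compact(1)[OF cT] compact_continuous_image compact_imp_bounded by blast
    then show ?thesis by (auto simp: bounded_iff)
  qed
  then obtain R where R: "\<And>i x. x \<in> T \<Longrightarrow> \<bar>\<phi> x i\<bar> \<le> R i" by metis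
  show ?thesis
  proof (intro exI[of _ "\<Sum>i<k. \<bar>R i\<bar>"] ballI allI impI)
    fix x i assume "x \<in> T" "i < k"
    then show "\<bar>\<phi> x i\<bar> \<le> (\<Sum>i<k. \<bar>R i\<bar>)"
      using R[of x i] member_le_sum[of i "{..<k}" "\<lambda>i. \<bar>R i\<bar>"] by force
  qed
qed

text \<open>
  The right-hand side is continuous and positive on the compact product of \<open>S\<close> and the unit sphere of the
  norm that is the sum of the absolute values of the entries. Its minimum there is \<open>c\<close>.
\<close>
lemma compact_family_uniformly_injective:
  fixes f :: "nat \<Rightarrow> nat \<Rightarrow> 'a \<Rightarrow> complex"
  assumes S: "compactin J S"
    and f: "\<And>r j. r < p \<Longrightarrow> j < n \<Longrightarrow> continuous_map (subtopology J S) euclidean (f r j)"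
    and inj: "\<And>x \<xi>. x \<in> S \<Longrightarrow> \<forall>r<p. (\<Sum>j<n. f r j x * \<xi> j) = 0 \<Longrightarrow> \<forall>j<n. \<xi> j = 0"
  shows "\<exists>c>0. \<forall>x\<in>S. \<forall>\<xi>. c * (\<Sum>j<n. cmod (\<xi> j)) \<le> (\<Sum>r<p. cmod (\<Sum>j<n. f r j x * \<xi> j))"
proof -
  define Z where "Z = {\<xi>::nat \<Rightarrow> complex. (\<forall>j\<ge>n. \<xi> j = 0) \<and> (\<Sum>j<n. cmod (\<xi> j)) = 1}"
  define Y where "Y = prod_topology (subtopology J S) (top_of_set Z)"
  define Q where "Q z = (\<Sum>r<p. cmod (\<Sum>j<n. f r j (fst z) * snd z j))" for z
  have coord: "continuous_on A (\<lambda>\<xi>::nat \<Rightarrow> complex. \<xi> j)" for A j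
    by (rule continuous_on_subset[OF continuous_on_product_coordinates subset_UNIV])
  have "compact Z"
  proof -
    define C where "C = PiE UNIV (\<lambda>j. if j < n then cball (0::complex) 1 else {0})"
    have "compactin (product_topology (\<lambda>_. euclidean) UNIV) C"
      unfolding C_def by (subst compactin_PiE) auto
    then have "compact C" by (simp add: euclidean_product_topology)
    moreover have "closed {\<xi>::nat \<Rightarrow> complex. (\<Sum>j<n. cmod (\<xi> j)) = 1}"
      by (intro closed_Collect_eq continuous_intros coord)
    moreover have "Z = {\<xi>. (\<Sum>j<n. cmod (\<xi> j)) = 1} \<inter> C"
    proof -
      have "cmod (\<xi> i) \<le> 1" if "i < n" "(\<Sum>j<n. cmod (\<xi> j)) = 1" for \<xi> :: "nat \<Rightarrow> complex" and i
        using member_le_sum[of i "{..<n}" "\<lambda>j. cmod (\<xi> j)"] that by simp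
      moreover have "\<xi> \<in> C \<longleftrightarrow> (\<forall>j\<ge>n. \<xi> j = 0) \<and> (\<forall>j<n. cmod (\<xi> j) \<le> 1)" for \<xi>
      proof -
        have "\<xi> \<in> C \<longleftrightarrow> (\<forall>j. if j < n then cmod (\<xi> j) \<le> 1 else \<xi> j = 0)"
          unfolding C_def PiE_UNIV_domain Pi_iff by (intro iffI allI) (auto split: if_splits)
        then show ?thesis by (meson not_le)
      qed
      ultimately show ?thesis by (auto simp: Z_def)
    qed
    ultimately show ?thesis using closed_Int_compact by simp
  qed
  then have cY: "compact_space Y"
    unfolding Y_def using S by (simp add: compact_space_prod_topology compact_space_subtopology)
  have topY: "topspace Y = S \<times> Z"
    using compactin_subset_topspace[OF S] by (auto simp: Y_def)
  have f': "continuous_map Y euclidean (\<lambda>z. f r j (fst z))" if "r < p" "j < n" for r j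
    using continuous_map_compose[OF continuous_map_fst f[OF that]] by (simp add: Y_def comp_def)
  have "continuous_map (top_of_set Z) euclidean (\<lambda>\<xi>. \<xi> j)" for j using coord by simp
  from continuous_map_compose[OF continuous_map_snd this]
  have s': "continuous_map Y euclidean (\<lambda>z. snd z j)" for j by (simp add: Y_def comp_def)
  have "continuous_map Y euclideanreal Q"
    unfolding Q_def by (intro continuous_map_sum continuous_map_norm continuous_map_mult_complex f' s') auto
  then have "compact (Q ` (S \<times> Z))"
    using image_compactin[of Y "topspace Y" euclideanreal Q] cY topY by (simp add: compact_space_def)
  moreover have pos: "Q z > 0" if "z \<in> S \<times> Z" for z
  proof (rule ccontr)
    assume "\<not> Q z > 0"
    moreover have "Q z \<ge> 0" unfolding Q_def by (intro sum_nonneg) auto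
    ultimately have "Q z = 0" by simp
    then have "\<forall>r<p. (\<Sum>j<n. f r j (fst z) * snd z j) = 0"
      unfolding Q_def by (subst (asm) sum_nonneg_eq_0_iff) auto
    then have "\<forall>j<n. snd z j = 0" using inj[of "fst z"] that by auto
    then show False using that by (auto simp: Z_def)
  qed
  ultimately obtain c where c: "c > 0" "\<And>z. z \<in> S \<times> Z \<Longrightarrow> c \<le> Q z"
  proof (cases "S \<times> Z = {}")
    case True then show ?thesis using that[of 1] by auto
  next
    case False
    then obtain z where "z \<in> S \<times> Z" "\<forall>y\<in>S \<times> Z. Q z \<le> Q y"
      using compact_attains_inf[OF \<open>compact (Q ` (S \<times> Z))\<close>] by auto
    then show ?thesis using that[of "Q z"] pos by blast
  qed
  show ?thesis
  proof (intro exI[of _ c] conjI ballI allI)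
    show "c > 0" by (rule c(1))
    fix x \<xi> assume x: "x \<in> S"
    define s where "s = (\<Sum>j<n. cmod (\<xi> j))"
    have s0: "s \<ge> 0" unfolding s_def by (intro sum_nonneg) auto
    show "c * (\<Sum>j<n. cmod (\<xi> j)) \<le> (\<Sum>r<p. cmod (\<Sum>j<n. f r j x * \<xi> j))"
    proof (cases "s = 0")
      case True
      then show ?thesis unfolding s_def by (simp add: sum_nonneg)
    next
      case False
      define \<zeta> where "\<zeta> j = (if j < n then \<xi> j / s else 0)" for j
      have "(\<Sum>j<n. cmod (\<zeta> j)) = (\<Sum>j<n. cmod (\<xi> j) / s)"
        using s0 by (intro sum.cong) (auto simp: \<zeta>_def norm_divide)
      also have "\<dots> = 1" using False by (simp add: s_def flip: sum_divide_distrib)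
      finally have "(x, \<zeta>) \<in> S \<times> Z" using x by (simp add: Z_def \<zeta>_def)
      then have "c \<le> (\<Sum>r<p. cmod (\<Sum>j<n. f r j x * \<zeta> j))" using c(2) by (force simp: Q_def)
      then have "c * s \<le> (\<Sum>r<p. cmod (\<Sum>j<n. f r j x * \<zeta> j)) * s"
        using s0 by (rule mult_right_mono)
      also have "\<dots> = (\<Sum>r<p. cmod (\<Sum>j<n. f r j x * \<xi> j))"
        unfolding sum_distrib_right
      proof (rule sum.cong[OF refl])
        fix r
        have "cmod (\<Sum>j<n. f r j x * \<zeta> j) * s = cmod ((\<Sum>j<n. f r j x * \<zeta> j) * s)"
          using s0 by (simp add: norm_mult)
        also have "(\<Sum>j<n. f r j x * \<zeta> j) * s = (\<Sum>j<n. f r j x * \<xi> j)"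
          unfolding sum_distrib_right using False by (intro sum.cong) (auto simp: \<zeta>_def)
        finally show "cmod (\<Sum>j<n. f r j x * \<zeta> j) * s = cmod (\<Sum>j<n. f r j x * \<xi> j)" .
      qed
      finally show ?thesis by (simp add: s_def)
    qed
  qed
qed

lemma compact_Hausdorff_bump:
  assumes J: "compact_space J" "Hausdorff_space J" and K: "closedin J K" "K \<subseteq> V" and V: "openin J V"
  shows "\<exists>\<rho>. continuous_map J euclideanreal \<rho> \<and> (\<forall>x\<in>topspace J. 0 \<le> \<rho> x \<and> \<rho> x \<le> 1) \<and>
           (\<forall>x\<in>topspace J - V. \<rho> x = 0) \<and> (\<forall>x\<in>K. \<rho> x = 1)"
proof -
  have "normal_space J" using J by (simp add: compact_Hausdorff_or_regular_imp_normal_space)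
  moreover have "closedin J (topspace J - V)" using V by blast
  moreover have "disjnt (topspace J - V) K" using K(2) by (auto simp: disjnt_def)
  ultimately obtain \<rho> where \<rho>: "continuous_map J (top_of_set {0..1::real}) \<rho>"
      "\<rho> ` (topspace J - V) \<subseteq> {0}" "\<rho> ` K \<subseteq> {1}"
    using Urysohn_lemma[of J "topspace J - V" K 0 1] K(1) by auto
  have "\<rho> ` topspace J \<subseteq> {0..1}" using continuous_map_image_subset_topspace[OF \<rho>(1)] by simp
  then show ?thesis
    using \<rho> by (intro exI[of _ \<rho>]) (auto simp: continuous_map_in_subtopology)
qed

lemma injective_perturbation:
  fixes f g :: "nat \<Rightarrow> nat \<Rightarrow> complex"
  assumes c: "c * (\<Sum>j<n. cmod (\<xi> j)) \<le> (\<Sum>r<p. cmod (\<Sum>j<n. f r j * \<xi> j))"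
    and small: "(\<Sum>r<p. \<Sum>j<n. cmod (g r j - f r j)) < c"
    and zero: "\<forall>r<p. (\<Sum>j<n. g r j * \<xi> j) = 0"
  shows "\<forall>j<n. \<xi> j = 0"
proof -
  define s where "s = (\<Sum>j<n. cmod (\<xi> j))"
  have s0: "0 \<le> s" unfolding s_def by (intro sum_nonneg) auto
  have le: "cmod (\<xi> j) \<le> s" if "j < n" for j
    unfolding s_def using that by (intro member_le_sum) auto
  have "c * s \<le> (\<Sum>r<p. cmod (\<Sum>j<n. f r j * \<xi> j))" using c by (simp add: s_def)
  also have "\<dots> \<le> (\<Sum>r<p. \<Sum>j<n. cmod (g r j - f r j) * s)"
  proof (rule sum_mono)
    fix r assume "r \<in> {..<p}"
    then have "(\<Sum>j<n. g r j * \<xi> j) = 0" using zero by simp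
    then have eq: "(\<Sum>j<n. f r j * \<xi> j) = - (\<Sum>j<n. (g r j - f r j) * \<xi> j)"
      by (simp add: left_diff_distrib sum_subtractf)
    show "cmod (\<Sum>j<n. f r j * \<xi> j) \<le> (\<Sum>j<n. cmod (g r j - f r j) * s)"
      unfolding eq norm_minus_cancel
      by (rule sum_norm_le) (use le in \<open>auto simp: norm_mult intro!: mult_left_mono\<close>)
  qed
  also have "\<dots> = (\<Sum>r<p. \<Sum>j<n. cmod (g r j - f r j)) * s"
    by (simp add: sum_distrib_right)
  finally have "(c - (\<Sum>r<p. \<Sum>j<n. cmod (g r j - f r j))) * s \<le> 0"
    by (simp add: left_diff_distrib)
  then have "s \<le> 0" using small by (simp add: mult_le_0_iff)
  then show ?thesis using le by (metis norm_le_zero_iff order_trans)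
qed

section \<open>Linear functionals and local frames of complex vector bundles\<close>

definition linear_on_fibre :: "('a, 'e) vbundle \<Rightarrow> 'a \<Rightarrow> ('e \<Rightarrow> complex) \<Rightarrow> bool" where
  "linear_on_fibre E x a \<longleftrightarrow>
     (\<forall>u\<in>carrier (fib E x). \<forall>v\<in>carrier (fib E x). a (u \<oplus>\<^bsub>fib E x\<^esub> v) = a u + a v) \<and>
     (\<forall>c. \<forall>u\<in>carrier (fib E x). a (c \<odot>\<^bsub>fib E x\<^esub> u) = c * a u)"

definition linear_functional :: "'a topology \<Rightarrow> ('a, 'e) vbundle \<Rightarrow> ('e \<Rightarrow> complex) \<Rightarrow> bool" where
  "linear_functional J E a \<longleftrightarrow>
     continuous_map (total E) euclidean a \<and> (\<forall>x\<in>topspace J. linear_on_fibre E x a)"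

text \<open>
  A local trivialization in coordinates: \<open>\<xi>\<close> are the fibre coordinates and \<open>s\<close> the dual sections. Duality is
  expressed by the last clause, the expansion of an arbitrary functional, so that no sums in the modules
  \<open>fib E x\<close> have to be formed.
\<close>
definition local_frame ::
  "'a topology \<Rightarrow> ('a, 'e) vbundle \<Rightarrow> nat \<Rightarrow> 'a set \<Rightarrow> (nat \<Rightarrow> 'e \<Rightarrow> complex) \<Rightarrow> (nat \<Rightarrow> 'a \<Rightarrow> 'e) \<Rightarrow> bool" where
  "local_frame J E n U \<xi> s \<longleftrightarrow>
     (\<forall>j. continuous_map (subtopology (total E) {u \<in> topspace (total E). proj E u \<in> U}) euclidean (\<xi> j)) \<and>
     (\<forall>j. \<forall>x\<in>U. linear_on_fibre E x (\<xi> j)) \<and>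
     (\<forall>j<n. continuous_map (subtopology J U) (total E) (s j)) \<and>
     (\<forall>j<n. \<forall>x\<in>U. s j x \<in> carrier (fib E x)) \<and>
     (\<forall>x\<in>U. \<forall>c. \<exists>u\<in>carrier (fib E x). \<forall>j<n. \<xi> j u = c j) \<and>
     (\<forall>x\<in>U. \<forall>u\<in>carrier (fib E x). \<forall>v\<in>carrier (fib E x). (\<forall>j<n. \<xi> j u = \<xi> j v) \<longrightarrow> u = v) \<and>
     (\<forall>x\<in>U. \<forall>a. linear_on_fibre E x a \<longrightarrow>
        (\<forall>u\<in>carrier (fib E x). a u = (\<Sum>j<n. a (s j x) * \<xi> j u)))"

lemma
  assumes "local_frame J E n U \<xi> s"
  shows frame_coord_continuous: "continuous_map (subtopology (total E) {u \<in> topspace (total E). proj E u \<in> U}) euclidean (\<xi> j)"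
    and frame_coord_linear: "x \<in> U \<Longrightarrow> linear_on_fibre E x (\<xi> j)"
    and frame_section_continuous: "j < n \<Longrightarrow> continuous_map (subtopology J U) (total E) (s j)"
    and frame_section_in_fibre: "j < n \<Longrightarrow> x \<in> U \<Longrightarrow> s j x \<in> carrier (fib E x)"
    and frame_coords_surj: "x \<in> U \<Longrightarrow> \<exists>u\<in>carrier (fib E x). \<forall>j<n. \<xi> j u = c j"
    and frame_coords_inj: "x \<in> U \<Longrightarrow> u \<in> carrier (fib E x) \<Longrightarrow> v \<in> carrier (fib E x) \<Longrightarrow> \<forall>j<n. \<xi> j u = \<xi> j v \<Longrightarrow> u = v"
    and frame_expansion: "x \<in> U \<Longrightarrow> linear_on_fibre E x a \<Longrightarrow> u \<in> carrier (fib E x) \<Longrightarrow> a u = (\<Sum>j<n. a (s j x) * \<xi> j u)"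
  using assms unfolding local_frame_def by simp_all

lemma linear_on_fibre_sum:
  assumes "\<And>i. i \<in> I \<Longrightarrow> linear_on_fibre E x (a i)"
  shows "linear_on_fibre E x (\<lambda>u. \<Sum>i\<in>I. a i u)"
  using assms unfolding linear_on_fibre_def by (simp add: sum.distrib sum_distrib_left)

lemma linear_on_fibre_mult:
  "linear_on_fibre E x a \<Longrightarrow> linear_on_fibre E x (\<lambda>u. c * a u)"
  unfolding linear_on_fibre_def by (simp add: algebra_simps)

lemma linear_on_fibre_add:
  "linear_on_fibre E x a \<Longrightarrow> linear_on_fibre E x b \<Longrightarrow> linear_on_fibre E x (\<lambda>u. a u + b u)"
  unfolding linear_on_fibre_def by (simp add: algebra_simps)

lemma linear_on_fibre_cong:
  assumes "linear_on_fibre E x a" "Module.module complex_ring (fib E x)"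
    and "\<And>u. u \<in> carrier (fib E x) \<Longrightarrow> b u = a u"
  shows "linear_on_fibre E x b"
proof -
  interpret M: Module.module complex_ring "fib E x" by fact
  have c: "c \<odot>\<^bsub>fib E x\<^esub> u \<in> carrier (fib E x)" if "u \<in> carrier (fib E x)" for c u
    using M.smult_closed[of c u] that by (simp add: complex_ring_def)
  show ?thesis
    using assms(1,3) c unfolding linear_on_fibre_def by (simp add: M.M.add.m_closed)
qed

lemma linear_functional_sum:
  "finite I \<Longrightarrow> (\<And>i. i \<in> I \<Longrightarrow> linear_functional J E (a i)) \<Longrightarrow> linear_functional J E (\<lambda>u. \<Sum>i\<in>I. a i u)"
  unfolding linear_functional_def by (auto intro: continuous_map_sum linear_on_fibre_sum)

lemma linear_functional_add:
  "linear_functional J E a \<Longrightarrow> linear_functional J E b \<Longrightarrow> linear_functional J E (\<lambda>u. a u + b u)"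
  unfolding linear_functional_def by (auto intro: continuous_map_add linear_on_fibre_add)

lemma linear_functional_minus:
  "linear_functional J E a \<Longrightarrow> linear_functional J E (\<lambda>u. - a u)"
  unfolding linear_functional_def using linear_on_fibre_mult[of E _ a "- 1"] by (auto intro: continuous_map_minus)

text \<open>
  Injectivity on the fibre over \<open>x\<close> of the linear map with the components \<open>q 0, ..., q (p - 1)\<close>.
\<close>
definition separates :: "('a, 'e) vbundle \<Rightarrow> nat \<Rightarrow> (nat \<Rightarrow> 'e \<Rightarrow> complex) \<Rightarrow> 'a \<Rightarrow> bool" where
  "separates E p q x \<longleftrightarrow>
     (\<forall>u\<in>carrier (fib E x). (\<forall>r<p. q r u = 0) \<longrightarrow> u = \<zero>\<^bsub>fib E x\<^esub>)"

locale complex_bundle =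
  fixes J :: "'a topology" and E :: "('a, 'e) vbundle" and n :: nat
  assumes vector_bundle: "complex_vector_bundle J E n"
begin

abbreviation fibre :: "'a \<Rightarrow> 'e set" where "fibre x \<equiv> carrier (fib E x)"

lemma proj_continuous: "continuous_map (total E) J (proj E)"
  using vector_bundle by (simp add: complex_vector_bundle_def)

lemma fibre_eq: "x \<in> topspace J \<Longrightarrow> fibre x = {u \<in> topspace (total E). proj E u = x}"
  using vector_bundle by (simp add: complex_vector_bundle_def)

lemma in_fibre_proj: "u \<in> topspace (total E) \<Longrightarrow> proj E u \<in> topspace J \<and> u \<in> fibre (proj E u)"
  using continuous_map_image_subset_topspace[OF proj_continuous] by (auto simp: fibre_eq)

lemma fibre_module: "x \<in> topspace J \<Longrightarrow> Module.module complex_ring (fib E x)"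
  using vector_bundle by (simp add: complex_vector_bundle_def)

lemma
  assumes x: "x \<in> topspace J"
  shows fibre_add_closed: "u \<in> fibre x \<Longrightarrow> v \<in> fibre x \<Longrightarrow> u \<oplus>\<^bsub>fib E x\<^esub> v \<in> fibre x"
    and fibre_smult_closed: "u \<in> fibre x \<Longrightarrow> c \<odot>\<^bsub>fib E x\<^esub> u \<in> fibre x"
    and fibre_zero_closed: "\<zero>\<^bsub>fib E x\<^esub> \<in> fibre x"
    and fibre_uminus_closed: "u \<in> fibre x \<Longrightarrow> \<ominus>\<^bsub>fib E x\<^esub> u \<in> fibre x"
    and fibre_add_uminus: "u \<in> fibre x \<Longrightarrow> u \<oplus>\<^bsub>fib E x\<^esub> (\<ominus>\<^bsub>fib E x\<^esub> u) = \<zero>\<^bsub>fib E x\<^esub>"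
    and fibre_zero_add_zero: "\<zero>\<^bsub>fib E x\<^esub> \<oplus>\<^bsub>fib E x\<^esub> \<zero>\<^bsub>fib E x\<^esub> = \<zero>\<^bsub>fib E x\<^esub>"
    and fibre_idempotent_zero: "u \<in> fibre x \<Longrightarrow> u \<oplus>\<^bsub>fib E x\<^esub> u = u \<Longrightarrow> u = \<zero>\<^bsub>fib E x\<^esub>"
    and fibre_uminus_uminus: "u \<in> fibre x \<Longrightarrow> \<ominus>\<^bsub>fib E x\<^esub> (\<ominus>\<^bsub>fib E x\<^esub> u) = u"
    and fibre_uminus_zero: "\<ominus>\<^bsub>fib E x\<^esub> \<zero>\<^bsub>fib E x\<^esub> = \<zero>\<^bsub>fib E x\<^esub>"
    and fibre_eq_of_diff_zero: "u \<in> fibre x \<Longrightarrow> v \<in> fibre x \<Longrightarrow> u \<oplus>\<^bsub>fib E x\<^esub> (\<ominus>\<^bsub>fib E x\<^esub> v) = \<zero>\<^bsub>fib E x\<^esub> \<Longrightarrow> u = v"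
    and fibre_smult_distrib: "u \<in> fibre x \<Longrightarrow> (c + d) \<odot>\<^bsub>fib E x\<^esub> u = c \<odot>\<^bsub>fib E x\<^esub> u \<oplus>\<^bsub>fib E x\<^esub> d \<odot>\<^bsub>fib E x\<^esub> u"
    and fibre_smult_assoc: "u \<in> fibre x \<Longrightarrow> (c * d) \<odot>\<^bsub>fib E x\<^esub> u = c \<odot>\<^bsub>fib E x\<^esub> (d \<odot>\<^bsub>fib E x\<^esub> u)"
proof -
  interpret M: Module.module complex_ring "fib E x" using fibre_module[OF x] .
  show "u \<in> fibre x \<Longrightarrow> v \<in> fibre x \<Longrightarrow> u \<oplus>\<^bsub>fib E x\<^esub> v \<in> fibre x" by (rule M.M.add.m_closed)
  show "u \<in> fibre x \<Longrightarrow> c \<odot>\<^bsub>fib E x\<^esub> u \<in> fibre x"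
    using M.smult_closed[of c u] by (simp add: complex_ring_def)
  show "\<zero>\<^bsub>fib E x\<^esub> \<in> fibre x" by simp
  show "u \<in> fibre x \<Longrightarrow> \<ominus>\<^bsub>fib E x\<^esub> u \<in> fibre x" by simp
  show "u \<in> fibre x \<Longrightarrow> u \<oplus>\<^bsub>fib E x\<^esub> (\<ominus>\<^bsub>fib E x\<^esub> u) = \<zero>\<^bsub>fib E x\<^esub>" by (rule M.M.r_neg)
  show "\<zero>\<^bsub>fib E x\<^esub> \<oplus>\<^bsub>fib E x\<^esub> \<zero>\<^bsub>fib E x\<^esub> = \<zero>\<^bsub>fib E x\<^esub>" by simp
  show "u \<in> fibre x \<Longrightarrow> u \<oplus>\<^bsub>fib E x\<^esub> u = u \<Longrightarrow> u = \<zero>\<^bsub>fib E x\<^esub>" by simp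
  show "u \<in> fibre x \<Longrightarrow> \<ominus>\<^bsub>fib E x\<^esub> (\<ominus>\<^bsub>fib E x\<^esub> u) = u" by simp
  show "\<ominus>\<^bsub>fib E x\<^esub> \<zero>\<^bsub>fib E x\<^esub> = \<zero>\<^bsub>fib E x\<^esub>" by simp
  show "u \<in> fibre x \<Longrightarrow> v \<in> fibre x \<Longrightarrow> u \<oplus>\<^bsub>fib E x\<^esub> (\<ominus>\<^bsub>fib E x\<^esub> v) = \<zero>\<^bsub>fib E x\<^esub> \<Longrightarrow> u = v"
    by (metis M.M.add.inv_closed M.M.minus_equality M.M.minus_minus)
  show "u \<in> fibre x \<Longrightarrow> (c + d) \<odot>\<^bsub>fib E x\<^esub> u = c \<odot>\<^bsub>fib E x\<^esub> u \<oplus>\<^bsub>fib E x\<^esub> d \<odot>\<^bsub>fib E x\<^esub> u"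
    using M.smult_l_distr[of c d u] by (simp add: complex_ring_def)
  show "u \<in> fibre x \<Longrightarrow> (c * d) \<odot>\<^bsub>fib E x\<^esub> u = c \<odot>\<^bsub>fib E x\<^esub> (d \<odot>\<^bsub>fib E x\<^esub> u)"
    using M.smult_assoc1[of c d u] by (simp add: complex_ring_def)
qed

lemma linear_zero:
  assumes "x \<in> topspace J" "linear_on_fibre E x a"
  shows "a \<zero>\<^bsub>fib E x\<^esub> = 0"
  using assms fibre_zero_closed[OF assms(1)] fibre_zero_add_zero[OF assms(1)] unfolding linear_on_fibre_def
  by (metis add_cancel_left_right)

lemma linear_uminus:
  assumes "x \<in> topspace J" "linear_on_fibre E x a" "u \<in> fibre x"
  shows "a (\<ominus>\<^bsub>fib E x\<^esub> u) = - a u"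
proof -
  have "a u + a (\<ominus>\<^bsub>fib E x\<^esub> u) = a (u \<oplus>\<^bsub>fib E x\<^esub> (\<ominus>\<^bsub>fib E x\<^esub> u))"
    using assms fibre_uminus_closed[OF assms(1,3)] unfolding linear_on_fibre_def by simp
  also have "\<dots> = 0" using fibre_add_uminus[OF assms(1,3)] linear_zero[OF assms(1,2)] by simp
  finally show ?thesis by (metis add.inverse_unique)
qed

text \<open>
  The section \<open>s j\<close> is the inverse image of the \<open>j\<close>-th unit vector under the trivialization. The expansion of a
  functional follows by building the coordinate vector of \<open>u\<close> up entry by entry.
\<close>
lemma local_frame_exists:
  assumes x0: "x0 \<in> topspace J"
  obtains U \<xi> s where "openin J U" "x0 \<in> U" "local_frame J E n U \<xi> s"
proof -
  obtain U h where U: "openin J U" "x0 \<in> U" and lt: "local_trivialization J E n U h"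
    using vector_bundle x0 unfolding complex_vector_bundle_def by blast
  define D where "D = {u \<in> topspace (total E). proj E u \<in> U}"
  have UJ: "U \<subseteq> topspace J" using U(1) by (rule openin_subset)
  have top_coord: "topspace (coord_space n) = {c::nat \<Rightarrow> complex. \<forall>i\<ge>n. c i = 0}"
    by (simp add: coord_space_def)
  obtain k where hk: "homeomorphic_maps (subtopology (total E) D) (prod_topology (subtopology J U) (coord_space n)) h k"
    using lt unfolding local_trivialization_def D_def homeomorphic_map_maps by blast
  have ch: "continuous_map (subtopology (total E) D) (prod_topology (subtopology J U) (coord_space n)) h"
    and ck: "continuous_map (prod_topology (subtopology J U) (coord_space n)) (subtopology (total E) D) k"
    and kh: "\<And>u. u \<in> D \<Longrightarrow> k (h u) = u"
    and hkk: "\<And>x c. x \<in> U \<Longrightarrow> \<forall>i\<ge>n. c i = 0 \<Longrightarrow> h (k (x, c)) = (x, c)"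
    using hk UJ unfolding homeomorphic_maps_def by (auto simp: top_coord D_def)
  have fst_h: "fst (h u) = proj E u" if "u \<in> D" for u
    using lt that unfolding local_trivialization_def D_def by blast
  have fibreD: "fibre x = {u \<in> D. proj E u = x}" if "x \<in> U" for x
    using that UJ fibre_eq[of x] by (auto simp: D_def)
  have kD: "k (x, c) \<in> D" if "x \<in> U" "\<forall>i\<ge>n. c i = 0" for x c
  proof -
    have "(x, c) \<in> topspace (prod_topology (subtopology J U) (coord_space n))"
      using that UJ by (auto simp: top_coord)
    from subsetD[OF continuous_map_image_subset_topspace[OF ck] imageI[OF this]] show ?thesis by simp
  qed
  have k_fibre: "k (x, c) \<in> fibre x" if "x \<in> U" "\<forall>i\<ge>n. c i = 0" for x c
    using kD[OF that] fst_h[OF kD[OF that]] hkk[OF that] fibreD[OF that(1)] by simp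
  define \<xi> where "\<xi> j u = snd (h u) j" for j u
  define e where "e j = (\<lambda>i. if i = j then 1 else 0 :: complex)" for j :: nat
  define s where "s j x = k (x, e j)" for j x
  have \<xi>k: "\<xi> j (k (x, c)) = c j" if "x \<in> U" "\<forall>i\<ge>n. c i = 0" for x c j
    using hkk[OF that] by (simp add: \<xi>_def)
  have \<xi>0: "\<xi> j u = 0" if "u \<in> D" "j \<ge> n" for j u
  proof -
    have "u \<in> topspace (subtopology (total E) D)" using that(1) by (simp add: D_def)
    from subsetD[OF continuous_map_image_subset_topspace[OF ch] imageI[OF this]]
    have "snd (h u) \<in> topspace (coord_space n)" by (simp add: mem_Times_iff)
    then show ?thesis using that(2) by (simp add: \<xi>_def top_coord)
  qed
  have \<xi>lin: "linear_on_fibre E x (\<xi> j)" if "x \<in> U" for j x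
    using lt that unfolding local_trivialization_def linear_on_fibre_def \<xi>_def by simp
  have uniq: "u = v" if "x \<in> U" "u \<in> fibre x" "v \<in> fibre x" "\<forall>j<n. \<xi> j u = \<xi> j v" for x u v
  proof -
    have D: "u \<in> D" "v \<in> D" "proj E u = proj E v" using that(2,3) fibreD[OF that(1)] by auto
    have "\<xi> j u = \<xi> j v" for j using that(4) \<xi>0[OF D(1)] \<xi>0[OF D(2)] by (cases "j < n") auto
    then have "snd (h u) = snd (h v)" unfolding \<xi>_def by (rule ext)
    then have "h u = h v" using fst_h[OF D(1)] fst_h[OF D(2)] D(3) by (simp add: prod_eq_iff)
    then show ?thesis using kh[OF D(1)] kh[OF D(2)] by metis
  qed
  have expand: "a u = (\<Sum>j<n. a (s j x) * \<xi> j u)"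
    if x: "x \<in> U" and a: "linear_on_fibre E x a" and u: "u \<in> fibre x" for x a u
  proof -
    have xJ: "x \<in> topspace J" using x UJ by auto
    define c where "c N = (\<lambda>j. if j < N then \<xi> j u else 0)" for N
    have c0: "\<forall>i\<ge>n. c N i = 0" if "N \<le> n" for N using that by (auto simp: c_def)
    have \<xi>c: "\<xi> j (k (x, c N)) = c N j" if "N \<le> n" for N j using \<xi>k[OF x c0[OF that]] .
    have e0: "\<forall>i\<ge>n. e N i = 0" if "N < n" for N using that by (auto simp: e_def)
    have "a (k (x, c N)) = (\<Sum>j<N. a (s j x) * \<xi> j u)" if "N \<le> n" for N
      using that
    proof (induction N)
      case 0
      have "k (x, c 0) = \<zero>\<^bsub>fib E x\<^esub>"
      proof (rule uniq[OF x])
        show "\<forall>j<n. \<xi> j (k (x, c 0)) = \<xi> j \<zero>\<^bsub>fib E x\<^esub>"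
          using \<xi>k[OF x c0[of 0]] linear_zero[OF xJ \<xi>lin[OF x]] by (simp add: c_def)
      qed (use k_fibre[OF x c0[of 0]] fibre_zero_closed[OF xJ] in auto)
      then show ?case using linear_zero[OF xJ a] by simp
    next
      case (Suc N)
      have kc: "k (x, c N) \<in> fibre x" using k_fibre[OF x c0] Suc.prems by simp
      have ks: "s N x \<in> fibre x" unfolding s_def using k_fibre[OF x e0] Suc.prems by simp
      have "k (x, c (Suc N)) = k (x, c N) \<oplus>\<^bsub>fib E x\<^esub> \<xi> N u \<odot>\<^bsub>fib E x\<^esub> s N x"
      proof (rule uniq[OF x])
        show "k (x, c (Suc N)) \<in> fibre x" using k_fibre[OF x c0] Suc.prems by simp
        show "k (x, c N) \<oplus>\<^bsub>fib E x\<^esub> \<xi> N u \<odot>\<^bsub>fib E x\<^esub> s N x \<in> fibre x"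
          using kc ks fibre_add_closed[OF xJ] fibre_smult_closed[OF xJ] by blast
        have "\<xi> j (k (x, c N) \<oplus>\<^bsub>fib E x\<^esub> \<xi> N u \<odot>\<^bsub>fib E x\<^esub> s N x) = \<xi> j (k (x, c N)) + \<xi> N u * \<xi> j (s N x)" for j
          using \<xi>lin[OF x, of j] kc ks fibre_smult_closed[OF xJ ks] unfolding linear_on_fibre_def by simp
        moreover have "\<xi> j (s N x) = e N j" for j unfolding s_def using \<xi>k[OF x e0] Suc.prems by simp
        ultimately show "\<forall>j<n. \<xi> j (k (x, c (Suc N))) = \<xi> j (k (x, c N) \<oplus>\<^bsub>fib E x\<^esub> \<xi> N u \<odot>\<^bsub>fib E x\<^esub> s N x)"
          using \<xi>c[of N] \<xi>c[of "Suc N"] Suc.prems by (simp add: c_def e_def less_Suc_eq)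
      qed
      then have "a (k (x, c (Suc N))) = a (k (x, c N)) + \<xi> N u * a (s N x)"
        using a kc ks fibre_smult_closed[OF xJ ks] unfolding linear_on_fibre_def by simp
      then show ?case using Suc.IH Suc.prems by simp
    qed
    moreover have "k (x, c n) = u"
      by (rule uniq[OF x k_fibre[OF x c0[OF order_refl]] u]) (simp add: \<xi>c, simp add: c_def)
    ultimately show ?thesis using order_refl by metis
  qed
  have "local_frame J E n U \<xi> s"
    unfolding local_frame_def
  proof (intro conjI allI ballI impI)
    fix j
    have "continuous_map (coord_space n) euclidean (\<lambda>c::nat \<Rightarrow> complex. c j)"
      unfolding coord_space_def
      by (intro continuous_map_from_subtopology continuous_map_product_projection) simp
    from continuous_map_compose[OF continuous_map_compose[OF ch continuous_map_snd] this]
    show "continuous_map (subtopology (total E) {u \<in> topspace (total E). proj E u \<in> U}) euclidean (\<xi> j)"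
      by (simp add: \<xi>_def[abs_def] comp_def D_def)
  next
    fix j assume "j < n"
    then have "e j \<in> topspace (coord_space n)" by (auto simp: top_coord e_def)
    then have "continuous_map (subtopology J U) (prod_topology (subtopology J U) (coord_space n)) (\<lambda>x. (x, e j))"
      by (intro continuous_map_pairedI) (auto simp: continuous_map_id[unfolded id_def])
    from continuous_map_compose[OF this ck]
    show "continuous_map (subtopology J U) (total E) (s j)"
      by (simp add: s_def[abs_def] comp_def continuous_map_in_subtopology)
  next
    fix j x assume "j < n" "x \<in> U"
    then show "s j x \<in> fibre x" unfolding s_def by (intro k_fibre) (auto simp: e_def)
  next
    fix x c assume x: "x \<in> U"
    define c' where "c' = (\<lambda>j. if j < n then c j else (0::complex))"
    have "k (x, c') \<in> fibre x" "\<forall>j<n. \<xi> j (k (x, c')) = c j"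
      using k_fibre[OF x, of c'] \<xi>k[OF x, of c'] by (simp_all add: c'_def)
    then show "\<exists>u\<in>fibre x. \<forall>j<n. \<xi> j u = c j" by blast
  qed (use \<xi>lin uniq expand in blast)+
  then show ?thesis using that U by blast
qed

lemma linear_functional_scale:
  assumes a: "linear_functional J E a" and \<rho>: "continuous_map J euclidean \<rho>"
  shows "linear_functional J E (\<lambda>u. \<rho> (proj E u) * a u)"
  unfolding linear_functional_def
proof (intro conjI ballI)
  have "continuous_map (total E) euclidean (\<lambda>u. \<rho> (proj E u))"
    using continuous_map_compose[OF proj_continuous \<rho>] by (simp add: comp_def)
  then show "continuous_map (total E) euclidean (\<lambda>u. \<rho> (proj E u) * a u)"
    using a by (intro continuous_map_mult_complex) (auto simp: linear_functional_def)
  fix x assume x: "x \<in> topspace J"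
  show "linear_on_fibre E x (\<lambda>u. \<rho> (proj E u) * a u)"
  proof (rule linear_on_fibre_cong[OF linear_on_fibre_mult fibre_module[OF x]])
    show "linear_on_fibre E x a" using a x by (simp add: linear_functional_def)
    show "\<rho> (proj E u) * a u = \<rho> x * a u" if "u \<in> fibre x" for u using that fibre_eq[OF x] by simp
  qed
qed

lemma functional_section_continuous:
  assumes "local_frame J E n U \<xi> s" "linear_functional J E a" "j < n" "T \<subseteq> U"
  shows "continuous_map (subtopology J T) euclidean (\<lambda>x. a (s j x))"
proof -
  have "continuous_map (subtopology J T) (total E) (s j)"
    by (rule continuous_map_from_subtopology_mono[OF frame_section_continuous[OF assms(1,3)] assms(4)])
  from continuous_map_compose[OF this, of euclidean a] assms(2) show ?thesis
    by (simp add: comp_def linear_functional_def)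
qed

lemma frame_coords_zero:
  assumes fr: "local_frame J E n U \<xi> s" and x: "x \<in> U" "x \<in> topspace J"
  shows "\<xi> j \<zero>\<^bsub>fib E x\<^esub> = 0"
    and "u \<in> fibre x \<Longrightarrow> \<forall>j<n. \<xi> j u = 0 \<Longrightarrow> u = \<zero>\<^bsub>fib E x\<^esub>"
proof -
  show z: "\<xi> j \<zero>\<^bsub>fib E x\<^esub> = 0" for j
    by (rule linear_zero[OF x(2) frame_coord_linear[OF fr x(1)]])
  show "u = \<zero>\<^bsub>fib E x\<^esub>" if "u \<in> fibre x" "\<forall>j<n. \<xi> j u = 0"
    by (rule frame_coords_inj[OF fr x(1) that(1) fibre_zero_closed[OF x(2)]]) (use that(2) z in simp)
qed

lemma separates_imp_matrix_injective:
  assumes fr: "local_frame J E n U \<xi> s" and x: "x \<in> U" "x \<in> topspace J"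
    and lin: "\<And>r. r < p \<Longrightarrow> linear_on_fibre E x (q r)"
    and sep: "separates E p q x" and z: "\<forall>r<p. (\<Sum>j<n. q r (s j x) * c j) = 0"
  shows "\<forall>j<n. c j = 0"
proof -
  obtain u where u: "u \<in> fibre x" "\<forall>j<n. \<xi> j u = c j" using frame_coords_surj[OF fr x(1)] ..
  have "q r u = 0" if "r < p" for r
    using frame_expansion[OF fr x(1) lin[OF that] u(1)] z that u(2) by simp
  then have "u = \<zero>\<^bsub>fib E x\<^esub>" using sep u(1) by (simp add: separates_def)
  then show ?thesis using u(2) frame_coords_zero(1)[OF fr x] by simp
qed

lemma matrix_injective_imp_separates:
  assumes fr: "local_frame J E n U \<xi> s" and x: "x \<in> U" "x \<in> topspace J"
    and q: "\<And>r u. r < p \<Longrightarrow> u \<in> fibre x \<Longrightarrow> q r u = (\<Sum>j<n. f r j * \<xi> j u)"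
    and inj: "\<And>c. \<forall>r<p. (\<Sum>j<n. f r j * c j) = 0 \<Longrightarrow> \<forall>j<n. c j = 0"
  shows "separates E p q x"
  unfolding separates_def
proof (intro ballI impI)
  fix u assume u: "u \<in> fibre x" and z: "\<forall>r<p. q r u = 0"
  then have "\<forall>r<p. (\<Sum>j<n. f r j * \<xi> j u) = 0" using q by simp
  then have "\<forall>j<n. \<xi> j u = 0" by (rule inj)
  then show "u = \<zero>\<^bsub>fib E x\<^esub>" by (rule frame_coords_zero(2)[OF fr x u])
qed

text \<open>
  In a frame the family is a matrix that depends continuously on the point. At \<open>x\<close> this matrix has a lower
  bound \<open>c\<close>, and it stays injective as long as the sum of the changes of its entries is below \<open>c\<close>.
\<close>
lemma separates_open:
  assumes q: "\<And>r. r < p \<Longrightarrow> linear_functional J E (q r)"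
    and x: "x \<in> topspace J" and sep: "separates E p q x"
  obtains W where "openin J W" "x \<in> W" "\<And>y. y \<in> W \<Longrightarrow> separates E p q y"
proof -
  obtain U \<xi> s where U: "openin J U" "x \<in> U" and fr: "local_frame J E n U \<xi> s"
    using local_frame_exists[OF x] .
  have UJ: "U \<subseteq> topspace J" using U(1) openin_subset by blast
  have lin: "linear_on_fibre E y (q r)" if "r < p" "y \<in> U" for r y
    using q[OF that(1)] that(2) UJ by (auto simp: linear_functional_def)
  define f where "f r j y = q r (s j y)" for r j y
  have cf: "continuous_map (subtopology J T) euclidean (f r j)" if "r < p" "j < n" "T \<subseteq> U" for r j T
    unfolding f_def by (rule functional_section_continuous[OF fr q[OF that(1)] that(2,3)])
  have "\<forall>j<n. \<zeta> j = 0" if "y \<in> {x}" "\<forall>r<p. (\<Sum>j<n. f r j y * \<zeta> j) = 0" for y \<zeta>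
  proof -
    have y: "y = x" using that(1) by simp
    show ?thesis
      by (rule separates_imp_matrix_injective[OF fr U(2) x lin sep]) (use that(2) U(2) in \<open>auto simp: f_def y\<close>)
  qed
  note inj = this
  have "\<exists>c>0. \<forall>y\<in>{x}. \<forall>\<zeta>. c * (\<Sum>j<n. cmod (\<zeta> j)) \<le> (\<Sum>r<p. cmod (\<Sum>j<n. f r j y * \<zeta> j))"
    by (rule compact_family_uniformly_injective[where J = J]) (use x U(2) in \<open>simp, simp add: cf\<close>, rule inj)
  then obtain c where c: "c > 0"
    "\<And>\<zeta>. c * (\<Sum>j<n. cmod (\<zeta> j)) \<le> (\<Sum>r<p. cmod (\<Sum>j<n. f r j x * \<zeta> j))"
    by (elim exE conjE) simp
  define d where "d y = (\<Sum>r<p. \<Sum>j<n. cmod (f r j y - f r j x))" for y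
  have cd: "continuous_map (subtopology J U) euclideanreal d"
    unfolding d_def using cf[OF _ _ order_refl]
    by (intro continuous_map_sum continuous_map_norm continuous_map_diff) auto
  define W where "W = {y \<in> topspace (subtopology J U). d y \<in> {..<c}}"
  have "openin (subtopology J U) W"
    unfolding W_def by (rule openin_continuous_map_preimage[OF cd]) simp
  then have "openin J W" using U(1) by (simp add: openin_open_subtopology)
  moreover have "x \<in> W" using c(1) U(2) x by (simp add: W_def d_def)
  moreover have "separates E p q y" if "y \<in> W" for y
  proof -
    have y: "y \<in> U" "y \<in> topspace J" "d y < c" using that by (auto simp: W_def)
    show ?thesis
    proof (rule matrix_injective_imp_separates[OF fr y(1,2), where f = "\<lambda>r j. f r j y"])
      show "q r u = (\<Sum>j<n. f r j y * \<xi> j u)" if "r < p" "u \<in> fibre y" for r u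
        unfolding f_def by (rule frame_expansion[OF fr y(1) lin[OF that(1) y(1)] that(2)])
      show "\<forall>j<n. \<zeta> j = 0" if "\<forall>r<p. (\<Sum>j<n. f r j y * \<zeta> j) = 0" for \<zeta>
        by (rule injective_perturbation[OF c(2)]) (use y(3) that in \<open>simp_all add: d_def\<close>)
    qed
  qed
  ultimately show ?thesis using that by blast
qed

text \<open>
  Extension by zero of a functional given over \<open>T\<close>. The closed sets over \<open>T\<close> and over the complement of \<open>V\<close>
  cover the total space, and on their intersection both definitions give \<open>0\<close>.
\<close>
lemma bump_functional:
  assumes fr: "local_frame J E n U \<xi> s" and T: "closedin J T" and V: "openin J V" "V \<subseteq> T" and TU: "T \<subseteq> U"
    and \<rho>: "continuous_map J euclideanreal \<rho>" "\<And>x. x \<in> topspace J \<Longrightarrow> x \<notin> V \<Longrightarrow> \<rho> x = 0"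
    and e: "continuous_map (subtopology J T) euclidean e"
  shows "linear_functional J E
    (\<lambda>u. if proj E u \<in> T then complex_of_real (\<rho> (proj E u)) * e (proj E u) * \<xi> j u else 0)"
    (is "linear_functional J E ?\<delta>")
  unfolding linear_functional_def
proof (intro conjI ballI)
  define D where "D b = {u \<in> topspace (total E). proj E u \<in> (if b then T else topspace J - V)}" for b
  define \<delta>' where "\<delta>' b u = (if b then complex_of_real (\<rho> (proj E u)) * e (proj E u) * \<xi> j u else 0)" for b u
  show "continuous_map (total E) euclidean ?\<delta>"
  proof (rule pasting_lemma_closed[where I = UNIV and T = D and f = \<delta>'])
    show "closedin (total E) (D b)" for b
    proof -
      have "closedin J (if b then T else topspace J - V)" using T V(1) by (cases b) auto
      then show ?thesis unfolding D_def by (rule closedin_continuous_map_preimage[OF proj_continuous])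
    qed
    show "continuous_map (subtopology (total E) (D b)) euclidean (\<delta>' b)" for b
    proof (cases b)
      case True
      have pr: "continuous_map (subtopology (total E) (D True)) (subtopology J T) (proj E)"
        by (intro continuous_map_into_subtopology continuous_map_from_subtopology proj_continuous)
          (auto simp: D_def)
      have "continuous_map (subtopology J T) euclidean (\<lambda>x. complex_of_real (\<rho> x))"
        by (intro continuous_map_complex_of_real continuous_map_from_subtopology \<rho>(1))
      from continuous_map_compose[OF pr this]
      have 1: "continuous_map (subtopology (total E) (D True)) euclidean (\<lambda>u. complex_of_real (\<rho> (proj E u)))"
        by (simp add: comp_def)
      from continuous_map_compose[OF pr e]
      have 2: "continuous_map (subtopology (total E) (D True)) euclidean (\<lambda>u. e (proj E u))"
        by (simp add: comp_def)
      have 3: "continuous_map (subtopology (total E) (D True)) euclidean (\<xi> j)"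
        by (rule continuous_map_from_subtopology_mono[OF frame_coord_continuous[OF fr]]) (use TU in \<open>auto simp: D_def\<close>)
      show ?thesis using True continuous_map_mult_complex[OF continuous_map_mult_complex[OF 1 2] 3]
        by (simp add: \<delta>'_def[abs_def])
    qed (simp add: \<delta>'_def[abs_def])
    show "\<delta>' b u = \<delta>' b' u" if "u \<in> topspace (total E) \<inter> D b \<inter> D b'" for b b' u
      using that \<rho>(2)[of "proj E u"] by (cases b; cases b') (auto simp: \<delta>'_def D_def)
    show "\<exists>b. b \<in> UNIV \<and> u \<in> D b \<and> ?\<delta> u = \<delta>' b u" if "u \<in> topspace (total E)" for u
      using that in_fibre_proj[OF that] V(2)
      by (intro exI[of _ "proj E u \<in> T"]) (auto simp: D_def \<delta>'_def)
  qed auto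
  fix x assume x: "x \<in> topspace J"
  have pr: "proj E u = x" if "u \<in> fibre x" for u using that fibre_eq[OF x] by simp
  show "linear_on_fibre E x ?\<delta>"
  proof (cases "x \<in> T")
    case True
    then have "linear_on_fibre E x (\<xi> j)" using frame_coord_linear[OF fr] TU by blast
    then show ?thesis
      by (rule linear_on_fibre_cong[OF linear_on_fibre_mult[where c = "complex_of_real (\<rho> x) * e x"] fibre_module[OF x]])
        (use True pr in auto)
  next
    case False
    have "linear_on_fibre E x (\<lambda>u. 0)" by (simp add: linear_on_fibre_def)
    then show ?thesis
      by (rule linear_on_fibre_cong[OF _ fibre_module[OF x]]) (use False pr in auto)
  qed
qed

end

section \<open>Quaternionic structures\<close>

locale quaternionic_bundle = complex_bundle +
  fixes \<iota>J :: "'a \<Rightarrow> 'a" and \<iota>E :: "'b \<Rightarrow> 'b"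
  assumes quaternionic: "quaternionic_structure J \<iota>J E \<iota>E"
    and \<iota>J_continuous: "continuous_map J J \<iota>J"
    and \<iota>J_involution: "x \<in> topspace J \<Longrightarrow> \<iota>J (\<iota>J x) = x"
begin

lemma \<iota>J_closed: "x \<in> topspace J \<Longrightarrow> \<iota>J x \<in> topspace J"
  using continuous_map_image_subset_topspace[OF \<iota>J_continuous] by blast

lemma \<iota>E_continuous: "continuous_map (total E) (total E) \<iota>E"
  and proj_\<iota>E: "u \<in> topspace (total E) \<Longrightarrow> proj E (\<iota>E u) = \<iota>J (proj E u)"
  using quaternionic unfolding quaternionic_structure_def by simp_all

lemma \<iota>E_fibre:
  assumes x: "x \<in> topspace J" and u: "u \<in> fibre x"
  shows "\<iota>E u \<in> fibre (\<iota>J x)"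
proof -
  have ut: "u \<in> topspace (total E)" "proj E u = x" using u fibre_eq[OF x] by auto
  then have "\<iota>E u \<in> topspace (total E)"
    using continuous_map_image_subset_topspace[OF \<iota>E_continuous] by blast
  then show ?thesis using proj_\<iota>E[OF ut(1)] ut(2) fibre_eq[OF \<iota>J_closed[OF x]] by simp
qed

lemma \<iota>E_add:
  "x \<in> topspace J \<Longrightarrow> u \<in> fibre x \<Longrightarrow> v \<in> fibre x \<Longrightarrow>
    \<iota>E (u \<oplus>\<^bsub>fib E x\<^esub> v) = \<iota>E u \<oplus>\<^bsub>fib E (\<iota>J x)\<^esub> \<iota>E v"
  and \<iota>E_square: "x \<in> topspace J \<Longrightarrow> u \<in> fibre x \<Longrightarrow> \<iota>E (\<iota>E u) = \<ominus>\<^bsub>fib E x\<^esub> u"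
  using quaternionic unfolding quaternionic_structure_def by simp_all

text \<open>
  Antilinearity for all complex scalars follows from the cases of real scalars and of \<open>\<i>\<close>.
\<close>
lemma \<iota>E_smult:
  assumes x: "x \<in> topspace J" and u: "u \<in> fibre x"
  shows "\<iota>E (c \<odot>\<^bsub>fib E x\<^esub> u) = cnj c \<odot>\<^bsub>fib E (\<iota>J x)\<^esub> \<iota>E u"
proof -
  have real: "\<iota>E (complex_of_real t \<odot>\<^bsub>fib E x\<^esub> v) = complex_of_real t \<odot>\<^bsub>fib E (\<iota>J x)\<^esub> \<iota>E v"
    if "v \<in> fibre x" for t v
    using quaternionic x that unfolding quaternionic_structure_def by simp
  have imag: "\<iota>E (\<i> \<odot>\<^bsub>fib E x\<^esub> v) = (- \<i>) \<odot>\<^bsub>fib E (\<iota>J x)\<^esub> \<iota>E v" if "v \<in> fibre x" for v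
    using quaternionic x that unfolding quaternionic_structure_def by simp
  note ix = \<iota>J_closed[OF x] and iu = \<iota>E_fibre[OF x u]
  define s t where "s = complex_of_real (Re c)" and "t = complex_of_real (Im c)"
  have c: "c = s + \<i> * t" "cnj c = s + (- \<i>) * t"
    by (simp_all add: s_def t_def complex_eq_iff)
  have "\<iota>E (c \<odot>\<^bsub>fib E x\<^esub> u) = \<iota>E (s \<odot>\<^bsub>fib E x\<^esub> u \<oplus>\<^bsub>fib E x\<^esub> \<i> \<odot>\<^bsub>fib E x\<^esub> (t \<odot>\<^bsub>fib E x\<^esub> u))"
    unfolding c(1) by (simp only: fibre_smult_distrib[OF x u] fibre_smult_assoc[OF x u])
  also have "\<dots> = s \<odot>\<^bsub>fib E (\<iota>J x)\<^esub> \<iota>E u \<oplus>\<^bsub>fib E (\<iota>J x)\<^esub> (- \<i>) \<odot>\<^bsub>fib E (\<iota>J x)\<^esub> (t \<odot>\<^bsub>fib E (\<iota>J x)\<^esub> \<iota>E u)"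
    using u fibre_smult_closed[OF x] by (simp add: \<iota>E_add[OF x] real[folded s_def t_def] imag s_def t_def)
  also have "\<dots> = cnj c \<odot>\<^bsub>fib E (\<iota>J x)\<^esub> \<iota>E u"
    unfolding c(2) by (simp only: fibre_smult_distrib[OF ix iu] fibre_smult_assoc[OF ix iu])
  finally show ?thesis .
qed

lemma \<iota>E_zero: "x \<in> topspace J \<Longrightarrow> \<iota>E \<zero>\<^bsub>fib E x\<^esub> = \<zero>\<^bsub>fib E (\<iota>J x)\<^esub>"
  by (metis \<iota>E_add \<iota>E_fibre \<iota>J_closed fibre_zero_closed fibre_zero_add_zero fibre_idempotent_zero)

text \<open>
  The conjugation makes \<open>a \<circ> \<iota>E\<close> complex-linear again. Like \<open>\<iota>E\<close>, the operation \<open>star\<close> is antilinear, maps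
  functionals over \<open>\<iota>J x\<close> to functionals over \<open>x\<close> and squares to \<open>-1\<close>.
\<close>
definition star :: "('b \<Rightarrow> complex) \<Rightarrow> 'b \<Rightarrow> complex" where
  "star a u = cnj (a (\<iota>E u))"

lemma star_linear_on_fibre:
  assumes x: "x \<in> topspace J" and a: "linear_on_fibre E (\<iota>J x) a"
  shows "linear_on_fibre E x (star a)"
  using a \<iota>E_fibre[OF x] unfolding linear_on_fibre_def star_def
  by (simp add: \<iota>E_add[OF x] \<iota>E_smult[OF x])

lemma star_linear_functional:
  assumes "linear_functional J E a"
  shows "linear_functional J E (star a)"
  unfolding linear_functional_def
proof (intro conjI ballI)
  have "continuous_map (total E) euclidean (\<lambda>u. a (\<iota>E u))"
    using continuous_map_compose[OF \<iota>E_continuous, of euclidean a] assms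
    by (simp add: comp_def linear_functional_def)
  then show "continuous_map (total E) euclidean (star a)"
    unfolding star_def[abs_def] by (rule continuous_map_cnj)
  show "linear_on_fibre E x (star a)" if "x \<in> topspace J" for x
    using star_linear_on_fibre[OF that] assms \<iota>J_closed[OF that] by (simp add: linear_functional_def)
qed

lemma star_star:
  assumes "x \<in> topspace J" "linear_on_fibre E x a" "u \<in> fibre x"
  shows "star (star a) u = - a u"
  using \<iota>E_square[OF assms(1,3)] linear_uminus[OF assms] by (simp add: star_def)

text \<open>
  Up to sign and conjugation these are the \<open>2m\<close> complex components of the equivariant map to \<open>H^m\<close> that belongs
  to \<open>a\<close>.
\<close>
definition with_star :: "nat \<Rightarrow> (nat \<Rightarrow> 'b \<Rightarrow> complex) \<Rightarrow> nat \<Rightarrow> 'b \<Rightarrow> complex" where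
  "with_star m a r = (if r < m then a r else star (a (r - m)))"

lemma with_star_linear:
  assumes "\<And>r. r < m \<Longrightarrow> linear_functional J E (a r)" "r < 2 * m"
  shows "linear_functional J E (with_star m a r)"
  using assms star_linear_functional by (simp add: with_star_def)

lemma with_star_zero_iff:
  "(\<forall>r<2 * m. with_star m a r u = 0) \<longleftrightarrow> (\<forall>r<m. a r u = 0 \<and> a r (\<iota>E u) = 0)"
proof
  assume L: "\<forall>r<2 * m. with_star m a r u = 0"
  show "\<forall>r<m. a r u = 0 \<and> a r (\<iota>E u) = 0"
  proof (intro allI impI)
    fix r assume "r < m"
    then show "a r u = 0 \<and> a r (\<iota>E u) = 0"
      using L[rule_format, of r] L[rule_format, of "m + r"] by (simp add: with_star_def star_def)
  qed
qed (auto simp: with_star_def star_def)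

text \<open>
  The map \<open>\<iota>E\<close> identifies the fibres over \<open>x\<close> and \<open>\<iota>J x\<close>, and up to sign and conjugation it exchanges \<open>a r\<close> and
  \<open>star (a r)\<close>.
\<close>
lemma separates_\<iota>J:
  assumes a: "\<And>r. r < m \<Longrightarrow> linear_functional J E (a r)" and x: "x \<in> topspace J"
    and sep: "separates E (2 * m) (with_star m a) (\<iota>J x)"
  shows "separates E (2 * m) (with_star m a) x"
  unfolding separates_def with_star_zero_iff
proof (intro ballI impI)
  fix u assume u: "u \<in> fibre x" and z: "\<forall>r<m. a r u = 0 \<and> a r (\<iota>E u) = 0"
  have "a r (\<iota>E (\<iota>E u)) = 0" if "r < m" for r
    using linear_uminus[OF x _ u, of "a r"] a[OF that] x z that
    by (simp add: \<iota>E_square[OF x u] linear_functional_def)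
  then have "\<iota>E u = \<zero>\<^bsub>fib E (\<iota>J x)\<^esub>"
    using sep \<iota>E_fibre[OF x u] z unfolding separates_def with_star_zero_iff by blast
  then have "\<ominus>\<^bsub>fib E x\<^esub> u = \<zero>\<^bsub>fib E x\<^esub>"
    using \<iota>E_square[OF x u] \<iota>E_zero[OF \<iota>J_closed[OF x]] \<iota>J_involution[OF x] by simp
  then show "u = \<zero>\<^bsub>fib E x\<^esub>" using fibre_uminus_uminus[OF x u] fibre_uminus_zero[OF x] by simp
qed

text \<open>
  Over a fixed point, \<open>star\<close> makes the dual of the fibre a quaternionic vector space of quaternionic dimension
  \<open>l\<close>. Below, \<open>K\<close> is \<open>star\<close> on coefficient vectors, and the \<open>\<alpha> r\<close> are a quaternionic basis: an independent system
  of vectors \<open>us r\<close> and \<open>K (us r)\<close> of maximal size. It spans the dual, so an element of the fibre on which all of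
  it vanishes is \<open>0\<close>.
\<close>
lemma fixed_fibre_quaternionic_coordinates:
  assumes x: "x \<in> topspace J" "\<iota>J x = x" and n: "n = 2 * l" and fr: "local_frame J E n U \<xi> s" and xU: "x \<in> U"
  shows "\<exists>\<alpha>. \<forall>u\<in>fibre x.
    (\<forall>r<l. (\<Sum>j<n. \<alpha> r j * \<xi> j u) = 0 \<and> (\<Sum>j<n. \<alpha> r j * \<xi> j (\<iota>E u)) = 0) \<longrightarrow> u = \<zero>\<^bsub>fib E x\<^esub>"
proof -
  interpret cvs: vector_space "\<lambda>c (f::nat \<Rightarrow> complex) j. c * f j"
    by unfold_locales (auto simp: algebra_simps fun_eq_iff)
  define W where "W = {\<alpha>::nat \<Rightarrow> complex. \<forall>j\<ge>n. \<alpha> j = 0}"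
  define A where "A \<alpha> u = (\<Sum>j<n. \<alpha> j * \<xi> j u)" for \<alpha> u
  define K where "K \<alpha> = (\<lambda>j. if j < n then star (A \<alpha>) (s j x) else 0)" for \<alpha>
  have linA: "linear_on_fibre E x (A \<alpha>)" for \<alpha>
    unfolding A_def by (intro linear_on_fibre_sum linear_on_fibre_mult frame_coord_linear[OF fr xU])
  have linS: "linear_on_fibre E x (star (A \<alpha>))" for \<alpha>
    using star_linear_on_fibre[OF x(1)] linA x(2) by simp
  have iu: "\<iota>E u \<in> fibre x" if "u \<in> fibre x" for u using \<iota>E_fibre[OF x(1) that] x(2) by simp
  have AK: "A (K \<alpha>) u = star (A \<alpha>) u" if "u \<in> fibre x" for \<alpha> u
  proof -
    have "star (A \<alpha>) u = (\<Sum>j<n. star (A \<alpha>) (s j x) * \<xi> j u)"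
      by (rule frame_expansion[OF fr xU linS that])
    also have "\<dots> = A (K \<alpha>) u" by (simp add: A_def K_def cong: sum.cong_simp)
    finally show ?thesis ..
  qed
  have sx: "s j x \<in> fibre x" if "j < n" for j by (rule frame_section_in_fibre[OF fr that xU])
  have K_add: "K (\<lambda>j. \<alpha> j + \<beta> j) = (\<lambda>j. K \<alpha> j + K \<beta> j)" for \<alpha> \<beta>
    by (auto simp: K_def star_def A_def distrib_right sum.distrib)
  have K_scale: "K (\<lambda>j. c * \<alpha> j) = (\<lambda>j. cnj c * K \<alpha> j)" for c \<alpha>
    by (auto simp: K_def star_def A_def mult.assoc simp flip: sum_distrib_left)
  have KW: "K \<alpha> \<in> W" for \<alpha> by (simp add: K_def W_def)
  have KK: "K (K \<alpha>) = (\<lambda>j. - 1 * \<alpha> j)" if "\<alpha> \<in> W" for \<alpha>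
  proof
    fix i
    show "K (K \<alpha>) i = - 1 * \<alpha> i"
    proof (cases "i < n")
      case True
      obtain u where u: "u \<in> fibre x" "\<forall>j<n. \<xi> j u = (if j = i then 1 else 0)"
        using frame_coords_surj[OF fr xU, of "\<lambda>j. if j = i then 1 else 0"] by auto
      have ev: "A \<beta> u = \<beta> i" for \<beta>
      proof -
        have "A \<beta> u = (\<Sum>j<n. if j = i then \<beta> j else 0)"
          unfolding A_def by (intro sum.cong) (use u(2) in auto)
        then show ?thesis using True by simp
      qed
      have "A (K (K \<alpha>)) u = star (star (A \<alpha>)) u"
        using AK[OF u(1)] AK[OF iu[OF u(1)]] by (simp add: star_def)
      also have "\<dots> = - A \<alpha> u" by (rule star_star[OF x(1) linA u(1)])
      finally show ?thesis by (simp add: ev)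
    next
      case False
      then show ?thesis using that by (simp add: K_def W_def)
    qed
  qed
  define B where "B i us = us ` {..<i} \<union> (K \<circ> us) ` {..<i}" for i and us :: "nat \<Rightarrow> nat \<Rightarrow> complex"
  define good where "good i us \<longleftrightarrow> (\<forall>r<i. us r \<in> W) \<and> cvs.independent (B i us) \<and> card (B i us) = 2 * i" for i us
  define e where "e j = (\<lambda>i. if i = j then 1 else 0 :: complex)" for j :: nat
  have eW: "e j \<in> W" if "j < n" for j using that by (simp add: e_def W_def)
  have We: "W \<subseteq> cvs.span (e ` {..<n})"
  proof
    fix \<alpha> assume "\<alpha> \<in> W"
    have "(\<lambda>i. if i < N then \<alpha> i else 0) \<in> cvs.span (e ` {..<n})" if "N \<le> n" for N
      using that
    proof (induction N)
      case 0
      have "(\<lambda>i. if i < 0 then \<alpha> i else 0) = (0 :: nat \<Rightarrow> complex)" by auto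
      then show ?case using cvs.span_zero by simp
    next
      case (Suc N)
      have eq: "(\<lambda>i. if i < Suc N then \<alpha> i else 0) = (\<lambda>i. if i < N then \<alpha> i else 0) + (\<lambda>j. \<alpha> N * e N j)"
        by (auto simp: e_def fun_eq_iff less_Suc_eq)
      have "e N \<in> cvs.span (e ` {..<n})" using Suc.prems by (intro cvs.span_base) auto
      then show ?case unfolding eq using Suc by (intro cvs.span_add cvs.span_scale) auto
    qed
    moreover have "(\<lambda>i. if i < n then \<alpha> i else 0) = \<alpha>"
      using \<open>\<alpha> \<in> W\<close> by (auto simp: W_def fun_eq_iff)
    ultimately show "\<alpha> \<in> cvs.span (e ` {..<n})" by (metis order_refl)
  qed
  have BW: "B i us \<subseteq> W" if "good i us" for i us
    using that KW by (auto simp: good_def B_def)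
  have bound: "i \<le> l" if "good i us" for i us
  proof -
    have "card (B i us) \<le> card (e ` {..<n})"
      using cvs.independent_span_bound[of "e ` {..<n}" "B i us"] that BW[OF that] We by (auto simp: good_def)
    also have "\<dots> \<le> n" using card_image_le[of "{..<n}" e] by simp
    finally show ?thesis using that n by (simp add: good_def)
  qed
  define G where "G = {i. \<exists>us. good i us}"
  have "good 0 us" for us by (simp add: good_def B_def cvs.independent_empty)
  then have "G \<noteq> {}" by (auto simp: G_def)
  moreover have "finite G" using bound by (intro finite_subset[of G "{..l}"]) (auto simp: G_def)
  ultimately have "Max G \<in> G" and max: "\<And>i' us'. good i' us' \<Longrightarrow> i' \<le> Max G"
    by (simp_all add: Max_in) (auto simp: G_def intro!: Max_ge)
  then obtain us where "good (Max G) us" by (auto simp: G_def)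
  define i where "i = Max G"
  have g: "good i us" and max: "\<And>i' us'. good i' us' \<Longrightarrow> i' \<le> i"
    using \<open>good (Max G) us\<close> max by (simp_all add: i_def)
  have Kspan: "K \<beta> \<in> cvs.span (B i us)" if "\<beta> \<in> cvs.span (B i us)" for \<beta>
    using that
  proof (induction rule: cvs.span_induct_alt)
    case base
    have "K 0 = 0" by (simp add: fun_eq_iff K_def star_def A_def)
    then show ?case using cvs.span_zero by metis
  next
    case (step c \<beta> \<gamma>)
    have "K \<beta> \<in> cvs.span (B i us)"
    proof (cases "\<beta> \<in> us ` {..<i}")
      case True
      then show ?thesis by (intro cvs.span_base) (auto simp: B_def)
    next
      case False
      then obtain r where r: "r < i" "\<beta> = K (us r)" using step(1) by (auto simp: B_def)
      then have "us r \<in> cvs.span (B i us)" "us r \<in> W"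
        using g by (auto simp: B_def good_def intro: cvs.span_base)
      then show ?thesis unfolding r(2) KK[OF \<open>us r \<in> W\<close>] by (intro cvs.span_scale)
    qed
    then have "(\<lambda>j. cnj c * K \<beta> j) + K \<gamma> \<in> cvs.span (B i us)"
      using step(2) by (intro cvs.span_add cvs.span_scale)
    also have "(\<lambda>j. cnj c * K \<beta> j) + K \<gamma> = K ((\<lambda>j. c * \<beta> j) + \<gamma>)"
      using K_add[of "\<lambda>j. c * \<beta> j" \<gamma>] K_scale[of c \<beta>] by (auto simp: fun_eq_iff plus_fun_def)
    finally show ?case .
  qed
  have spanW: "W \<subseteq> cvs.span (B i us)"
  proof (rule ccontr)
    assume "\<not> ?thesis"
    then obtain v where v: "v \<in> W" "v \<notin> cvs.span (B i us)" by blast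
    \<comment> \<open>If K v = c v + w with w in the span, then applying K shows that (1 + \<bar>c\<bar>^2) v is in the span.\<close>
    have Kv: "K v \<notin> cvs.span (insert v (B i us))"
    proof
      assume "K v \<in> cvs.span (insert v (B i us))"
      then obtain c where "K v - (\<lambda>j. c * v j) \<in> cvs.span (B i us)"
        unfolding cvs.span_breakdown_eq ..
      moreover define w where "w = K v - (\<lambda>j. c * v j)"
      ultimately have w: "w \<in> cvs.span (B i us)" by simp
      have Kw: "K w = (\<lambda>j. - 1 * v j) + (\<lambda>j. - cnj c * K v j)"
      proof -
        have "w = (\<lambda>j. K v j + - c * v j)" by (auto simp: w_def)
        then have "K w = (\<lambda>j. K (K v) j + K (\<lambda>j. - c * v j) j)" by (simp only: K_add)
        then show ?thesis using K_scale[of "- c" v] KK[OF v(1)] by (auto simp: fun_eq_iff)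
      qed
      have "K w + (\<lambda>j. cnj c * w j) \<in> cvs.span (B i us)"
        by (intro cvs.span_add cvs.span_scale Kspan w)
      also have "K w + (\<lambda>j. cnj c * w j) = (\<lambda>j. - (1 + cnj c * c) * v j)"
        unfolding Kw by (auto simp: w_def fun_eq_iff algebra_simps)
      finally have sp: "(\<lambda>j. - (1 + cnj c * c) * v j) \<in> cvs.span (B i us)" .
      define d where "d = 1 + cnj c * c"
      have "cnj c * c = complex_of_real ((cmod c)\<^sup>2)" by (simp add: complex_norm_square mult.commute del: of_real_power)
      then have d: "d = complex_of_real (1 + (cmod c)\<^sup>2)" by (simp add: d_def)
      have "1 + (cmod c)\<^sup>2 \<noteq> 0" using zero_le_power2[of "cmod c"] by linarith
      then have nz: "d \<noteq> 0" unfolding d of_real_eq_0_iff .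
      have "(\<lambda>j. - inverse d * (- d * v j)) \<in> cvs.span (B i us)"
        using cvs.span_scale[OF sp[folded d_def], of "- inverse d"] .
      also have "(\<lambda>j. - inverse d * (- d * v j)) = v"
        using nz by (intro ext) (simp add: field_simps)
      finally have "v \<in> cvs.span (B i us)" .
      then show False using v(2) by simp
    qed
    define us' where "us' = us(i := v)"
    have B': "B (Suc i) us' = insert (K v) (insert v (B i us))"
    proof -
      have "us' ` {..<i} = us ` {..<i}" "(K \<circ> us') ` {..<i} = (K \<circ> us) ` {..<i}"
        by (auto simp: us'_def intro!: image_cong)
      moreover have "us' i = v" by (simp add: us'_def)
      ultimately show ?thesis unfolding B_def lessThan_Suc image_insert comp_apply by (simp add: insert_commute)
    qed
    have "v \<notin> B i us" by (rule contrapos_nn[OF v(2)]) (rule cvs.span_base)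
    moreover have "K v \<notin> insert v (B i us)" by (rule contrapos_nn[OF Kv]) (rule cvs.span_base)
    moreover have "finite (B i us)" by (simp add: B_def)
    ultimately have "good (Suc i) us'"
      using g v Kv unfolding good_def B' by (auto simp: us'_def cvs.independent_insert)
    then show False using max by fastforce
  qed
  show ?thesis
  proof (intro exI[of _ "\<lambda>r j. if r < i then us r j else 0"] ballI impI)
    fix u assume u: "u \<in> fibre x"
      and z: "\<forall>r<l. (\<Sum>j<n. (if r < i then us r j else 0) * \<xi> j u) = 0 \<and>
                    (\<Sum>j<n. (if r < i then us r j else 0) * \<xi> j (\<iota>E u)) = 0"
    have zr: "A (us r) u = 0 \<and> A (us r) (\<iota>E u) = 0" if "r < i" for r
      using z[rule_format, of r] that bound[OF g] by (simp add: A_def)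
    have zB: "A \<beta> u = 0" if "\<beta> \<in> B i us" for \<beta>
      using that zr AK[OF u] by (auto simp: B_def star_def)
    have zspan: "A \<beta> u = 0" if "\<beta> \<in> cvs.span (B i us)" for \<beta>
      using that
    proof (induction rule: cvs.span_induct_alt)
      case base show ?case by (simp add: A_def)
    next
      case (step c \<beta> \<gamma>)
      have "A ((\<lambda>j. c * \<beta> j) + \<gamma>) u = c * A \<beta> u + A \<gamma> u"
        by (simp add: A_def distrib_right sum.distrib sum_distrib_left mult.assoc)
      then show ?case by (simp only: zB[OF step(1)] step(2) mult_zero_right add_0_right)
    qed
    have "\<xi> j u = 0" if "j < n" for j
    proof -
      have "A (e j) u = (\<Sum>i<n. if i = j then \<xi> j u else 0)"
        unfolding A_def by (intro sum.cong) (auto simp: e_def)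
      then have "A (e j) u = \<xi> j u" using that by simp
      then show ?thesis using zspan eW[OF that] spanW by auto
    qed
    then show "u = \<zero>\<^bsub>fib E x\<^esub>" by (intro frame_coords_zero(2)[OF fr xU x(1) u]) simp
  qed
qed

section \<open>General position away from the fixed points\<close>

text \<open>
  In the frame over \<open>T\<close>, let \<open>f\<close> be the matrix of \<open>with_star m a\<close>, let \<open>g\<close> be a Lipschitz approximation of it and \<open>b\<close> a
  generic small constant matrix for which \<open>g + b\<close> is injective throughout \<open>T\<close>. The matrix is changed by \<open>\<rho>\<close> times
  \<open>e = g + b - f\<close>, where \<open>\<rho>\<close> is \<open>1\<close> on \<open>K\<close> and \<open>0\<close> outside \<open>V\<close>. Thus it becomes \<open>g + b\<close> on \<open>K\<close>, and it stays injective
  over \<open>S\<close> because \<open>e\<close> is small.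

  The functionals \<open>\<Delta> r\<close> that represent this change vanish outside \<open>T\<close>. Over \<open>T\<close> their \<open>star\<close> vanishes, as \<open>\<iota>J\<close> moves \<open>T\<close>
  off itself. Since \<open>star (star (\<Delta> r)) = - \<Delta> r\<close>, adding \<open>\<Delta> r - star (\<Delta> (m + r))\<close> to \<open>a r\<close> changes both halves of
  \<open>with_star m a\<close> over \<open>T\<close> as required.
\<close>
lemma general_position_step:
  assumes comp: "compact_space J" and Haus: "Hausdorff_space J"
    and a: "\<And>r. r < m \<Longrightarrow> linear_functional J E (a r)"
    and dim: "k + 2 * n < 2 * (2 * m) + 2"
    and S: "closedin J S" "\<And>x. x \<in> S \<Longrightarrow> separates E (2 * m) (with_star m a) x"
    and fr: "local_frame J E n U \<xi> s"
    and \<phi>: "homeomorphic_map (subtopology J U') (subtopology (Euclidean_space k) (\<phi> ` U')) \<phi>"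
    and K: "closedin J K" "K \<subseteq> V" and V: "openin J V" "V \<subseteq> T"
    and T: "closedin J T" "T \<subseteq> U" "T \<subseteq> U'" "\<And>x. x \<in> T \<Longrightarrow> \<iota>J x \<notin> T"
  shows "\<exists>a'. (\<forall>r<m. linear_functional J E (a' r)) \<and>
    (\<forall>x\<in>S \<union> K. separates E (2 * m) (with_star m a') x)"
proof -
  define p where "p = 2 * m"
  define q where "q = with_star m a"
  have TJ: "T \<subseteq> topspace J" and SJ: "S \<subseteq> topspace J"
    using T(1) S(1) closedin_subset by auto
  have q: "linear_functional J E (q r)" if "r < p" for r
    unfolding q_def by (rule with_star_linear[OF a]) (use that in \<open>simp_all add: p_def\<close>)
  have cT: "compactin J T" using closedin_compact_space[OF comp T(1)] .
  define f where "f r j x = q r (s j x)" for r j x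
  have cf: "continuous_map (subtopology J X) euclidean (f r j)" if "X \<subseteq> T" "r < p" "j < n" for r j X
    unfolding f_def
    by (rule functional_section_continuous[OF fr q[OF that(2)] that(3)]) (use that(1) T(2) in blast)
  have lin: "linear_on_fibre E x (q r)" if "r < p" "x \<in> topspace J" for r x
    using q[OF that(1)] that(2) by (simp add: linear_functional_def)
  have expand: "q r u = (\<Sum>j<n. f r j x * \<xi> j u)" if "r < p" "x \<in> T" "u \<in> fibre x" for r x u
    unfolding f_def using that T(2) TJ by (intro frame_expansion[OF fr] lin) auto
  \<comment> \<open>If a point of S lies outside T but its image under \<iota>J lies in T, its fibre is affected as well; such images are put into S2.\<close>
  define S' where "S' = {x \<in> topspace J. \<iota>J x \<in> S}"
  define S2 where "S2 = T \<inter> (S \<union> S')"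
  have "closedin J S'" unfolding S'_def by (rule closedin_continuous_map_preimage[OF \<iota>J_continuous S(1)])
  then have "closedin J S2" unfolding S2_def using S(1) T(1) by (intro closedin_Int closedin_Un)
  then have cS2: "compactin J S2" by (rule closedin_compact_space[OF comp])
  have sepS2: "separates E p q x" if "x \<in> S2" for x
  proof (cases "x \<in> S")
    case True then show ?thesis using S(2) by (simp add: p_def q_def)
  next
    case False
    then have "\<iota>J x \<in> S" "x \<in> topspace J" using that by (auto simp: S2_def S'_def)
    then show ?thesis using separates_\<iota>J[OF a] S(2) by (simp add: p_def q_def)
  qed
  have "\<exists>c>0. \<forall>x\<in>S2. \<forall>\<zeta>. c * (\<Sum>j<n. cmod (\<zeta> j)) \<le> (\<Sum>r<p. cmod (\<Sum>j<n. f r j x * \<zeta> j))"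
  proof (rule compact_family_uniformly_injective[OF cS2])
    show "continuous_map (subtopology J S2) euclidean (f r j)" if "r < p" "j < n" for r j
      using cf[OF _ that] by (simp add: S2_def)
    show "\<forall>j<n. \<zeta> j = 0" if "x \<in> S2" "\<forall>r<p. (\<Sum>j<n. f r j x * \<zeta> j) = 0" for x \<zeta>
    proof (rule separates_imp_matrix_injective[OF fr _ _ lin sepS2])
      show "x \<in> S2" "x \<in> U" "x \<in> topspace J" "x \<in> topspace J" using that(1) T(2) TJ by (auto simp: S2_def)
      show "\<forall>r<p. (\<Sum>j<n. q r (s j x) * \<zeta> j) = 0" using that(2) by (simp add: f_def)
    qed
  qed
  then obtain c where c: "c > 0"
    and cS: "\<And>x \<zeta>. x \<in> S2 \<Longrightarrow> c * (\<Sum>j<n. cmod (\<zeta> j)) \<le> (\<Sum>r<p. cmod (\<Sum>j<n. f r j x * \<zeta> j))"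
    by (elim exE conjE) simp
  \<comment> \<open>The p n entries of e are at most 2 \<epsilon>, so that their sum is below the lower bound c.\<close>
  define N where "N = real p * real n + 1"
  define \<epsilon> where "\<epsilon> = c / (4 * N)"
  have N: "N \<ge> 1" by (simp add: N_def)
  have \<epsilon>: "\<epsilon> > 0" unfolding \<epsilon>_def using c N by (intro divide_pos_pos) auto
  have \<epsilon>c: "real p * (real n * (2 * \<epsilon>)) < c"
  proof -
    have "c = 4 * (\<epsilon> * N)" using N by (simp add: \<epsilon>_def)
    also have "\<epsilon> * N = \<epsilon> * (real p * real n) + \<epsilon>" by (simp add: N_def distrib_left)
    finally have "c = 4 * (\<epsilon> * (real p * real n)) + 4 * \<epsilon>" by simp
    moreover have "0 \<le> \<epsilon> * (real p * real n)" using \<epsilon> by simp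
    moreover have "real p * (real n * (2 * \<epsilon>)) = 2 * (\<epsilon> * (real p * real n))" by simp
    ultimately show ?thesis using \<epsilon> by linarith
  qed
  have "\<exists>g. r < p \<longrightarrow> j < n \<longrightarrow> continuous_map (subtopology J T) euclidean g \<and> lipschitz_in_coords k \<phi> T g \<and>
      (\<forall>x\<in>T. cmod (f r j x - g x) < \<epsilon>)" for r j
  proof (cases "r < p \<and> j < n")
    case True
    then have "continuous_map (subtopology J T) euclidean (f r j)" using cf by blast
    from chart_lipschitz_approximation[OF \<phi> cT T(3) this \<epsilon>] show ?thesis by metis
  qed auto
  then obtain g where g: "\<And>r j. r < p \<Longrightarrow> j < n \<Longrightarrow> continuous_map (subtopology J T) euclidean (g r j)"
    "\<And>r j. r < p \<Longrightarrow> j < n \<Longrightarrow> lipschitz_in_coords k \<phi> T (g r j)"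
    "\<And>r j x. r < p \<Longrightarrow> j < n \<Longrightarrow> x \<in> T \<Longrightarrow> cmod (f r j x - g r j x) < \<epsilon>"
    by metis
  obtain b c' where c': "c' > 0" and b: "\<And>r j. cmod (b r j) \<le> \<epsilon>"
    and inj: "\<And>x \<zeta> t. x \<in> T \<Longrightarrow> \<forall>r<p. cmod (\<Sum>j<n. (g r j x + b r j) * \<zeta> j) \<le> t \<Longrightarrow>
        \<forall>j<n. c' * cmod (\<zeta> j) \<le> t"
  proof -
    obtain R where R: "\<forall>x\<in>T. \<forall>i<k. \<bar>\<phi> x i\<bar> \<le> R"
      using chart_coords_bounded[OF \<phi> cT T(3)] ..
    define I where "I = {..<p} \<times> {..<n}"
    have "\<exists>L\<ge>0. \<forall>x\<in>T. \<forall>y\<in>T. \<forall>\<delta>\<ge>0. (\<forall>i<k. \<bar>\<phi> x i - \<phi> y i\<bar> \<le> \<delta>) \<longrightarrow>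
        cmod (g (fst rj) (snd rj) x - g (fst rj) (snd rj) y) \<le> L * \<delta>" if "rj \<in> I" for rj
      using g(2)[of "fst rj" "snd rj"] that by (auto simp: I_def lipschitz_in_coords_def)
    then obtain L where L: "\<And>rj. rj \<in> I \<Longrightarrow> L rj \<ge> 0"
      "\<And>rj x y \<delta>. rj \<in> I \<Longrightarrow> x \<in> T \<Longrightarrow> y \<in> T \<Longrightarrow> \<delta> \<ge> 0 \<Longrightarrow> \<forall>i<k. \<bar>\<phi> x i - \<phi> y i\<bar> \<le> \<delta> \<Longrightarrow>
        cmod (g (fst rj) (snd rj) x - g (fst rj) (snd rj) y) \<le> L rj * \<delta>"
      by metis
    have "\<exists>B. \<forall>x\<in>T. cmod (g (fst rj) (snd rj) x) \<le> B" if "rj \<in> I" for rj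
    proof -
      have "compactin euclidean (g (fst rj) (snd rj) ` T)"
        by (rule image_compactin[where X = "subtopology J T"])
          (use cT that g(1) in \<open>auto simp: I_def compactin_subtopology\<close>)
      then have "bounded (g (fst rj) (snd rj) ` T)" using compact_imp_bounded by simp
      then show ?thesis by (auto simp: bounded_iff)
    qed
    then obtain B where B: "\<And>rj x. rj \<in> I \<Longrightarrow> x \<in> T \<Longrightarrow> cmod (g (fst rj) (snd rj) x) \<le> B rj"
      by metis
    have finI: "finite I" by (simp add: I_def)
    have "\<exists>b c. c > 0 \<and> (\<forall>r j. cmod (b r j) \<le> \<epsilon>) \<and>
           (\<forall>x\<in>T. \<forall>\<zeta> t. (\<forall>r<p. cmod (\<Sum>j<n. (g r j x + b r j) * \<zeta> j) \<le> t) \<longrightarrow>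
              (\<forall>j<n. c * cmod (\<zeta> j) \<le> t))"
    proof (rule generic_translate_uniformly_injective[where k = k and \<phi> = \<phi> and R = R
          and G = "\<Sum>rj\<in>I. \<bar>B rj\<bar>" and L = "\<Sum>rj\<in>I. L rj"])
      show "\<bar>\<phi> x i\<bar> \<le> R" if "x \<in> T" "i < k" for x i using R that by simp
      show "cmod (g r j x) \<le> (\<Sum>rj\<in>I. \<bar>B rj\<bar>)" if "x \<in> T" "r < p" "j < n" for x r j
      proof -
        have I: "(r, j) \<in> I" using that by (simp add: I_def)
        have "cmod (g r j x) \<le> \<bar>B (r, j)\<bar>" using B[OF I that(1)] by simp
        also have "\<dots> \<le> (\<Sum>rj\<in>I. \<bar>B rj\<bar>)" by (rule member_le_sum[OF I]) (use finI in auto)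
        finally show ?thesis .
      qed
      show "cmod (g r j x - g r j y) \<le> (\<Sum>rj\<in>I. L rj) * \<delta>"
        if "x \<in> T" "y \<in> T" "r < p" "j < n" "0 \<le> \<delta>" "\<And>i. i < k \<Longrightarrow> \<bar>\<phi> x i - \<phi> y i\<bar> \<le> \<delta>" for x y r j \<delta>
      proof -
        have I: "(r, j) \<in> I" using that by (simp add: I_def)
        have "cmod (g r j x - g r j y) \<le> L (r, j) * \<delta>" using L(2)[OF I that(1,2,5)] that(6) by simp
        also have "L (r, j) \<le> (\<Sum>rj\<in>I. L rj)" by (rule member_le_sum[OF I]) (use finI L(1) in auto)
        finally show ?thesis using that(5) by (simp add: mult_right_mono)
      qed
      show "k + 2 * n < 2 * p + 2" using dim by (simp add: p_def)
    qed (rule \<epsilon>)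
    then obtain b c where bc: "c > 0" "\<forall>r j. cmod (b r j) \<le> \<epsilon>"
      "\<forall>x\<in>T. \<forall>\<zeta> t. (\<forall>r<p. cmod (\<Sum>j<n. (g r j x + b r j) * \<zeta> j) \<le> t) \<longrightarrow>
              (\<forall>j<n. c * cmod (\<zeta> j) \<le> t)"
      by (elim exE conjE)
    show thesis
    proof (rule that[where b = b and c' = c])
      show "c > 0" by (rule bc(1))
      show "cmod (b r j) \<le> \<epsilon>" for r j using bc(2) by simp
      show "\<forall>j<n. c * cmod (\<zeta> j) \<le> t"
        if "x \<in> T" "\<forall>r<p. cmod (\<Sum>j<n. (g r j x + b r j) * \<zeta> j) \<le> t" for x \<zeta> t
        using bc(3)[THEN bspec, OF that(1), THEN spec, THEN spec, THEN mp, OF that(2)] .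
    qed
  qed
  define e where "e r j x = g r j x + b r j - f r j x" for r j x
  have e_small: "cmod (e r j x) \<le> 2 * \<epsilon>" if "r < p" "j < n" "x \<in> T" for r j x
  proof -
    have "e r j x = b r j - (f r j x - g r j x)" by (simp add: e_def)
    then have "cmod (e r j x) \<le> cmod (b r j) + cmod (f r j x - g r j x)"
      using norm_triangle_ineq4 by metis
    then show ?thesis using b[of r j] g(3)[OF that] by simp
  qed
  have ce: "continuous_map (subtopology J T) euclidean (e r j)" if "r < p" "j < n" for r j
    unfolding e_def using cf[OF order_refl that] g(1)[OF that]
    by (intro continuous_map_diff continuous_map_add) auto
  obtain \<rho> where c\<rho>: "continuous_map J euclideanreal \<rho>"
    and \<rho>01: "\<forall>x\<in>topspace J. 0 \<le> \<rho> x \<and> \<rho> x \<le> 1"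
    and \<rho>V: "\<forall>x\<in>topspace J - V. \<rho> x = 0" and \<rho>K: "\<forall>x\<in>K. \<rho> x = 1"
    using compact_Hausdorff_bump[OF comp Haus K V(1)] by (elim exE conjE)
  define bump where "bump r j u = (if proj E u \<in> T then complex_of_real (\<rho> (proj E u)) * e r j (proj E u) * \<xi> j u else 0)"
    for r j u
  have bump: "linear_functional J E (bump r j)" if "r < p" "j < n" for r j
    unfolding bump_def by (rule bump_functional[OF fr T(1) V T(2) c\<rho> _ ce[OF that]]) (use \<rho>V in auto)
  define \<Delta> where "\<Delta> r u = (\<Sum>j<n. bump r j u)" for r u
  have \<Delta>: "linear_functional J E (\<Delta> r)" if "r < p" for r
    unfolding \<Delta>_def by (rule linear_functional_sum) (use bump that in auto)
  have \<Delta>0: "\<Delta> r u = 0" if "x \<in> topspace J" "u \<in> fibre x" "x \<notin> T" for r u x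
    using that fibre_eq[OF that(1)] by (simp add: \<Delta>_def bump_def)
  have \<Delta>T: "\<Delta> r u = (\<Sum>j<n. (complex_of_real (\<rho> x) * e r j x) * \<xi> j u)" if "x \<in> T" "u \<in> fibre x" for r u x
    using that fibre_eq[of x] TJ by (auto simp: \<Delta>_def bump_def)
  define a' where "a' r u = a r u + \<Delta> r u + - star (\<Delta> (m + r)) u" for r u
  have a': "linear_functional J E (a' r)" if "r < m" for r
    unfolding a'_def
    by (intro linear_functional_add linear_functional_minus star_linear_functional a \<Delta>)
      (use that in \<open>auto simp: p_def\<close>)
  have q'T: "with_star m a' r u = q r u + \<Delta> r u"
    if r: "r < p" and x: "x \<in> topspace J" "\<iota>J x \<notin> T" and u: "u \<in> fibre x" for r x u
  proof (cases "r < m")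
    case True
    have "\<Delta> (m + r) (\<iota>E u) = 0" by (rule \<Delta>0[OF \<iota>J_closed[OF x(1)] \<iota>E_fibre[OF x(1) u] x(2)])
    then show ?thesis using True by (simp add: with_star_def q_def a'_def star_def)
  next
    case False
    then have r': "m + (r - m) = r" by simp
    have "\<Delta> (r - m) (\<iota>E u) = 0" by (rule \<Delta>0[OF \<iota>J_closed[OF x(1)] \<iota>E_fibre[OF x(1) u] x(2)])
    moreover have "star (star (\<Delta> r)) u = - \<Delta> r u"
      using \<Delta>[OF r] x(1) by (intro star_star[OF x(1) _ u]) (simp add: linear_functional_def)
    ultimately show ?thesis using False r' by (simp add: with_star_def q_def a'_def star_def)
  qed
  have claim: "separates E p (with_star m a') x" if x: "x \<in> S2 \<union> K" for x
  proof -
    have xT: "x \<in> T" using x K(2) V(2) by (auto simp: S2_def)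
    then have xJ: "x \<in> topspace J" and xU: "x \<in> U" using TJ T(2) by auto
    show ?thesis
    proof (rule matrix_injective_imp_separates[OF fr xU xJ, where f = "\<lambda>r j. f r j x + complex_of_real (\<rho> x) * e r j x"])
      show "with_star m a' r u = (\<Sum>j<n. (f r j x + complex_of_real (\<rho> x) * e r j x) * \<xi> j u)"
        if "r < p" "u \<in> fibre x" for r u
        using q'T[OF that(1) xJ T(4)[OF xT] that(2)] expand[OF that(1) xT that(2)] \<Delta>T[OF xT that(2)]
        by (simp add: distrib_right sum.distrib)
      show "\<forall>j<n. \<zeta> j = 0" if z: "\<forall>r<p. (\<Sum>j<n. (f r j x + complex_of_real (\<rho> x) * e r j x) * \<zeta> j) = 0" for \<zeta>
      proof (cases "x \<in> K")
        case True
        then have "\<rho> x = 1" using \<rho>K by simp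
        then have "\<forall>r<p. cmod (\<Sum>j<n. (g r j x + b r j) * \<zeta> j) \<le> 0"
          using z by (simp add: e_def)
        from inj[OF xT this] c' show ?thesis by (simp add: mult_le_0_iff)
      next
        case False
        then have "x \<in> S2" using x by simp
        show ?thesis
        proof (rule injective_perturbation[OF cS[OF \<open>x \<in> S2\<close>] _ z])
          have "(\<Sum>r<p. \<Sum>j<n. cmod (f r j x + complex_of_real (\<rho> x) * e r j x - f r j x)) \<le> (\<Sum>r<p. \<Sum>j<n. 2 * \<epsilon>)"
          proof (intro sum_mono)
            fix r j assume "r \<in> {..<p}" "j \<in> {..<n}"
            then have "cmod (e r j x) \<le> 2 * \<epsilon>" using e_small xT by simp
            then have "\<bar>\<rho> x\<bar> * cmod (e r j x) \<le> 1 * (2 * \<epsilon>)"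
              using \<rho>01 xJ by (intro mult_mono) auto
            then show "cmod (f r j x + complex_of_real (\<rho> x) * e r j x - f r j x) \<le> 2 * \<epsilon>"
              by (simp add: norm_mult)
          qed
          also have "\<dots> = real p * (real n * (2 * \<epsilon>))" by simp
          finally show "(\<Sum>r<p. \<Sum>j<n. cmod (f r j x + complex_of_real (\<rho> x) * e r j x - f r j x)) < c"
            using \<epsilon>c by simp
        qed
      qed
    qed
  qed
  show ?thesis
  proof (intro exI[of _ a'] conjI allI impI ballI)
    show "linear_functional J E (a' r)" if "r < m" for r by (rule a'[OF that])
    fix x assume x: "x \<in> S \<union> K"
    show "separates E (2 * m) (with_star m a') x"
    proof (cases "x \<in> T")
      case True
      then show ?thesis using claim[of x] x by (auto simp: S2_def p_def)
    next
      case False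
      then have xS: "x \<in> S" using x K(2) V(2) by auto
      then have xJ: "x \<in> topspace J" using SJ by auto
      show ?thesis
      proof (cases "\<iota>J x \<in> T")
        case True
        then have "\<iota>J x \<in> S2" using xS \<iota>J_involution[OF xJ] \<iota>J_closed[OF xJ] by (simp add: S2_def S'_def)
        then show ?thesis using separates_\<iota>J[OF a' xJ] claim by (simp add: p_def)
      next
        case nT: False
        have "with_star m a' r u = with_star m a r u" if "r < 2 * m" "u \<in> fibre x" for r u
          using q'T[OF _ xJ nT that(2), of r] \<Delta>0[OF xJ that(2) False] that(1) by (simp add: p_def q_def)
        then show ?thesis using S(2)[OF xS] unfolding separates_def by simp
      qed
    qed
  qed
qed

section \<open>Separating families and equivariant monomorphisms\<close>

text \<open>
  Over a fixed point \<open>y\<close>, the functionals \<open>a r\<close> and \<open>star (a r)\<close> depend only on the values of \<open>a r\<close> over \<open>y\<close> itself.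
  So the family can be replaced by quaternionic coordinates over \<open>x\<close> by means of a bump function at \<open>x\<close> that
  vanishes on \<open>F\<close>.
\<close>
lemma fixed_point_step:
  assumes comp: "compact_space J" and Haus: "Hausdorff_space J"
    and nl: "n = 2 * l" "l \<le> m"
    and a: "\<And>r. r < m \<Longrightarrow> linear_functional J E (a r)"
    and F: "finite F" "F \<subseteq> fixed_points J \<iota>J" "\<And>y. y \<in> F \<Longrightarrow> separates E (2 * m) (with_star m a) y"
    and x: "x \<in> fixed_points J \<iota>J" "x \<notin> F"
  shows "\<exists>a'. (\<forall>r<m. linear_functional J E (a' r)) \<and>
    (\<forall>y\<in>insert x F. separates E (2 * m) (with_star m a') y)"
proof -
  have xJ: "x \<in> topspace J" and ix: "\<iota>J x = x" using x(1) by (auto simp: fixed_points_def)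
  obtain U \<xi> s where U: "openin J U" "x \<in> U" and fr: "local_frame J E n U \<xi> s"
    using local_frame_exists[OF xJ] .
  obtain \<alpha> where \<alpha>: "\<forall>u\<in>fibre x.
      (\<forall>r<l. (\<Sum>j<n. \<alpha> r j * \<xi> j u) = 0 \<and> (\<Sum>j<n. \<alpha> r j * \<xi> j (\<iota>E u)) = 0) \<longrightarrow> u = \<zero>\<^bsub>fib E x\<^esub>"
    using fixed_fibre_quaternionic_coordinates[OF xJ ix nl(1) fr U(2)] ..
  have FJ: "F \<subseteq> topspace J" using F(2) by (auto simp: fixed_points_def)
  have clF: "closedin J F" using F(1) FJ Haus by (simp add: closedin_Hausdorff_finite)
  then have "openin J (U - F)" using U(1) by (simp add: openin_diff)
  moreover have "neighbourhood_base_of (closedin J) J"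
    unfolding neighbourhood_base_of_closedin by (rule compact_Hausdorff_imp_regular_space[OF comp Haus])
  ultimately obtain V T where V: "openin J V" "x \<in> V" "V \<subseteq> T" and T: "closedin J T" "T \<subseteq> U - F"
    using U(2) x(2) unfolding neighbourhood_base_of by (metis DiffI)
  have TU: "T \<subseteq> U" using T(2) by auto
  have "closedin J {x}" using xJ Haus by (simp add: closedin_Hausdorff_finite)
  then obtain \<rho> where c\<rho>: "continuous_map J euclideanreal \<rho>"
    and \<rho>V: "\<forall>y\<in>topspace J - V. \<rho> y = 0" and \<rho>x: "\<forall>y\<in>{x}. \<rho> y = 1"
    using compact_Hausdorff_bump[OF comp Haus _ _ V(1), of "{x}"] V(2) by auto
  define \<beta> where "\<beta> r j = (if r < l then \<alpha> r j else 0)" for r j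
  define bump where "bump r j u = (if proj E u \<in> T then complex_of_real (\<rho> (proj E u)) * \<beta> r j * \<xi> j u else 0)"
    for r j u
  have bump: "linear_functional J E (bump r j)" for r j
    unfolding bump_def by (rule bump_functional[OF fr T(1) V(1,3) TU c\<rho>]) (use \<rho>V in auto)
  define a' where "a' r u = complex_of_real (1 - \<rho> (proj E u)) * a r u + (\<Sum>j<n. bump r j u)" for r u
  have a': "linear_functional J E (a' r)" if "r < m" for r
    unfolding a'_def
  proof (intro linear_functional_add linear_functional_sum bump)
    show "linear_functional J E (\<lambda>u. complex_of_real (1 - \<rho> (proj E u)) * a r u)"
    proof (rule linear_functional_scale[OF a[OF that]])
      show "continuous_map J euclidean (\<lambda>x. complex_of_real (1 - \<rho> x))"
        by (intro continuous_map_complex_of_real continuous_map_diff c\<rho>) auto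
    qed
  qed auto
  have at_x: "a' r u = (\<Sum>j<n. \<beta> r j * \<xi> j u)" if "u \<in> fibre x" for r u
  proof -
    have "proj E u = x" using that fibre_eq[OF xJ] by simp
    moreover have "\<rho> x = 1" using \<rho>x by simp
    moreover have "x \<in> T" using V(2,3) by auto
    ultimately show ?thesis by (simp add: a'_def bump_def)
  qed
  have at_F: "a' r u = a r u" if "y \<in> F" "u \<in> fibre y" for r u y
  proof -
    have y: "y \<in> topspace J" "y \<notin> T" "y \<notin> V" using that(1) FJ T(2) V(3) by auto
    then have "\<rho> y = 0" using \<rho>V by simp
    moreover have "proj E u = y" using that(2) fibre_eq[OF y(1)] by simp
    ultimately show ?thesis using y(2) by (simp add: a'_def bump_def)
  qed
  have fixed_fibre: "\<iota>E u \<in> fibre y" if "y \<in> fixed_points J \<iota>J" "u \<in> fibre y" for u y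
    using \<iota>E_fibre[of y u] that by (auto simp: fixed_points_def)
  show ?thesis
  proof (intro exI[of _ a'] conjI allI impI ballI)
    show "linear_functional J E (a' r)" if "r < m" for r by (rule a'[OF that])
    fix y assume "y \<in> insert x F"
    then consider "y = x" | "y \<in> F" by auto
    then show "separates E (2 * m) (with_star m a') y"
    proof cases
      case 1
      show ?thesis
        unfolding 1 separates_def with_star_zero_iff
      proof (intro ballI impI)
        fix u assume u: "u \<in> fibre x" and z: "\<forall>r<m. a' r u = 0 \<and> a' r (\<iota>E u) = 0"
        have "(\<Sum>j<n. \<alpha> r j * \<xi> j u) = 0 \<and> (\<Sum>j<n. \<alpha> r j * \<xi> j (\<iota>E u)) = 0" if "r < l" for r
          using z[rule_format, of r] that nl(2) at_x[OF u, of r] at_x[OF fixed_fibre[OF x(1) u], of r]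
          by (simp add: \<beta>_def)
        then show "u = \<zero>\<^bsub>fib E x\<^esub>" by (intro \<alpha>[rule_format, OF u]) simp
      qed
    next
      case 2
      then have yfix: "y \<in> fixed_points J \<iota>J" using F(2) by auto
      show ?thesis
        using F(3)[OF 2] unfolding separates_def with_star_zero_iff
        by (simp add: at_F[OF 2] fixed_fibre[OF yfix])
    qed
  qed
qed

lemma separating_at_fixed_points:
  assumes comp: "compact_space J" and Haus: "Hausdorff_space J" and nl: "n = 2 * l" "l \<le> m"
    and F: "finite F" "F \<subseteq> fixed_points J \<iota>J"
  shows "\<exists>a. (\<forall>r<m. linear_functional J E (a r)) \<and> (\<forall>y\<in>F. separates E (2 * m) (with_star m a) y)"
  using F
proof (induction F rule: finite_induct)
  case empty
  have "linear_functional J E (\<lambda>u. 0)" by (simp add: linear_functional_def linear_on_fibre_def)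
  then show ?case by auto
next
  case (insert x F)
  then obtain a where a: "\<And>r. r < m \<Longrightarrow> linear_functional J E (a r)"
    "\<And>y. y \<in> F \<Longrightarrow> separates E (2 * m) (with_star m a) y" by auto
  have "F \<subseteq> fixed_points J \<iota>J" "x \<in> fixed_points J \<iota>J" using insert.prems by auto
  from fixed_point_step[OF comp Haus nl a(1) insert.hyps(1) this(1) a(2) this(2) insert.hyps(2)]
  show ?case .
qed

text \<open>
  The fixed points form a closed discrete subset of a compact space, hence a finite set \<open>F\<close>. Each of them has a closed
  neighbourhood on which the family \<open>a0\<close> made for \<open>F\<close> separates. Every other point has a closed neighbourhood by which
  the set of points with separation can be enlarged (\<open>general_position_step\<close>). Finitely many of these
  neighbourhoods cover \<open>J\<close>; those of the points in \<open>F\<close> have to be taken first.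
\<close>
lemma separating_family_exists:
  assumes comp: "compact_space J" and Haus: "Hausdorff_space J" and nl: "n = 2 * l" "l \<le> m"
    and dim: "k + 2 * n < 2 * (2 * m) + 2"
    and charts: "\<And>x. x \<in> topspace J \<Longrightarrow> \<exists>U \<phi>. x \<in> U \<and> chart k J (U, \<phi>)"
    and iso: "isolated_set J (fixed_points J \<iota>J)"
  shows "\<exists>a. (\<forall>r<m. linear_functional J E (a r)) \<and> (\<forall>x\<in>topspace J. separates E (2 * m) (with_star m a) x)"
proof -
  define F where "F = fixed_points J \<iota>J"
  have "closedin J F"
    using closedin_continuous_maps_eq[OF Haus \<iota>J_continuous continuous_map_id] by (simp add: F_def fixed_points_def)
  then have "compactin J F" by (rule closedin_compact_space[OF comp])
  then have "compact_space (discrete_topology F)"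
    using iso by (simp add: compactin_subspace isolated_set_def F_def)
  then have "finite F" by (simp add: compact_space_discrete_topology)
  then obtain a0 where a0: "\<And>r. r < m \<Longrightarrow> linear_functional J E (a0 r)"
    "\<And>y. y \<in> F \<Longrightarrow> separates E (2 * m) (with_star m a0) y"
    using separating_at_fixed_points[OF comp Haus nl] by (metis F_def order_refl)
  define good where "good S \<longleftrightarrow> closedin J S \<and>
    (\<exists>a. (\<forall>r<m. linear_functional J E (a r)) \<and> (\<forall>x\<in>S. separates E (2 * m) (with_star m a) x))" for S
  have nbhd: "\<exists>V T. openin J V \<and> closedin J T \<and> x \<in> V \<and> V \<subseteq> T \<and> T \<subseteq> G" if "openin J G" "x \<in> G" for x G
  proof -
    have "neighbourhood_base_of (closedin J) J"
      unfolding neighbourhood_base_of_closedin by (rule compact_Hausdorff_imp_regular_space[OF comp Haus])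
    then show ?thesis using that unfolding neighbourhood_base_of by metis
  qed
  have near_fixed: "\<exists>W K. openin J W \<and> closedin J K \<and> x \<in> W \<and> W \<subseteq> K \<and>
      (\<forall>y\<in>K. separates E (2 * m) (with_star m a0) y)" if x: "x \<in> F" for x
  proof -
    have "x \<in> topspace J" using x by (simp add: F_def fixed_points_def)
    then obtain G where "openin J G" "x \<in> G" "\<And>y. y \<in> G \<Longrightarrow> separates E (2 * m) (with_star m a0) y"
      using separates_open[OF with_star_linear[OF a0(1)] _ a0(2)[OF x]] by metis
    then show ?thesis using nbhd[of G x] by (meson subsetD)
  qed
  have near_free: "\<exists>W K. openin J W \<and> closedin J K \<and> x \<in> W \<and> W \<subseteq> K \<and> (\<forall>S. good S \<longrightarrow> good (S \<union> K))"
    if x: "x \<in> topspace J" "x \<notin> F" for x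
  proof -
    have "\<iota>J x \<noteq> x" using x by (simp add: F_def fixed_points_def)
    then obtain P Q where P: "openin J P" "x \<in> P" and Q: "openin J Q" "\<iota>J x \<in> Q" and PQ: "disjnt P Q"
      using Haus x(1) \<iota>J_closed[OF x(1)] unfolding Hausdorff_space_def by metis
    obtain U \<xi> s where U: "openin J U" "x \<in> U" and fr: "local_frame J E n U \<xi> s"
      using local_frame_exists[OF x(1)] .
    obtain U' \<phi> where U': "x \<in> U'" "chart k J (U', \<phi>)" using charts[OF x(1)] by blast
    define G where "G = P \<inter> {y \<in> topspace J. \<iota>J y \<in> Q} \<inter> U \<inter> U'"
    have "openin J G"
      unfolding G_def using P(1) U(1) U'(2) openin_continuous_map_preimage[OF \<iota>J_continuous Q(1)]
      by (intro openin_Int) (auto simp: chart_def)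
    moreover have "x \<in> G" using P(2) Q(2) U(2) U'(1) x(1) by (simp add: G_def)
    ultimately obtain V T where V: "openin J V" "x \<in> V" "V \<subseteq> T" and T: "closedin J T" "T \<subseteq> G"
      using nbhd[of G x] by auto
    obtain W K where W: "openin J W" "x \<in> W" "W \<subseteq> K" and K: "closedin J K" "K \<subseteq> V"
      using nbhd[OF V(1,2)] by auto
    have TT: "\<iota>J y \<notin> T" if "y \<in> T" for y using that T(2) PQ by (auto simp: G_def disjnt_def)
    have \<phi>: "homeomorphic_map (subtopology J U') (subtopology (Euclidean_space k) (\<phi> ` U')) \<phi>"
      using U'(2) by (simp add: chart_def)
    have TU: "T \<subseteq> U" "T \<subseteq> U'" using T(2) by (auto simp: G_def)
    have "good (S \<union> K)" if "good S" for S
    proof -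
      obtain a where a: "\<And>r. r < m \<Longrightarrow> linear_functional J E (a r)"
        "\<And>x. x \<in> S \<Longrightarrow> separates E (2 * m) (with_star m a) x" and S: "closedin J S"
        using \<open>good S\<close> by (auto simp: good_def)
      show ?thesis
        using general_position_step[OF comp Haus a(1) dim S a(2) fr \<phi> K V(1,3) T(1) TU TT] closedin_Un[OF S K(1)]
        unfolding good_def by blast
    qed
    then show ?thesis using W K(1) by blast
  qed
  have "\<exists>W K. openin J W \<and> closedin J K \<and> x \<in> W \<and> W \<subseteq> K \<and>
      (if x \<in> F then \<forall>y\<in>K. separates E (2 * m) (with_star m a0) y else \<forall>S. good S \<longrightarrow> good (S \<union> K))"
    if "x \<in> topspace J" for x
    using near_fixed[of x] near_free[OF that] by (cases "x \<in> F") simp_all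
  then obtain W K where WK: "\<And>x. x \<in> topspace J \<Longrightarrow> openin J (W x) \<and> closedin J (K x) \<and> x \<in> W x \<and> W x \<subseteq> K x \<and>
      (if x \<in> F then \<forall>y\<in>K x. separates E (2 * m) (with_star m a0) y else \<forall>S. good S \<longrightarrow> good (S \<union> K x))"
    by metis
  have "\<exists>\<F>. finite \<F> \<and> \<F> \<subseteq> W ` topspace J \<and> topspace J \<subseteq> \<Union>\<F>"
  proof (rule compactinD[of J "topspace J"])
    show "compactin J (topspace J)" using comp by (simp add: compact_space_def)
    show "\<And>C. C \<in> W ` topspace J \<Longrightarrow> openin J C" using WK by auto
    show "topspace J \<subseteq> \<Union>(W ` topspace J)" using WK by auto
  qed
  then obtain Z where Z: "finite Z" "Z \<subseteq> topspace J" "topspace J \<subseteq> (\<Union>x\<in>Z. W x)"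
    by (metis finite_subset_image)
  have "good (\<Union>x\<in>Z \<inter> F. K x)"
    unfolding good_def
  proof (intro conjI exI[of _ a0])
    show "closedin J (\<Union>x\<in>Z \<inter> F. K x)" using Z(1,2) WK by (intro closedin_Union) auto
    show "\<forall>x\<in>\<Union>x\<in>Z \<inter> F. K x. separates E (2 * m) (with_star m a0) x"
    proof
      fix y assume "y \<in> (\<Union>x\<in>Z \<inter> F. K x)"
      then obtain x where "x \<in> Z" "x \<in> F" "y \<in> K x" by auto
      then show "separates E (2 * m) (with_star m a0) y" using WK[of x] Z(2) by auto
    qed
  qed (use a0(1) in auto)
  moreover have "good ((\<Union>x\<in>Z \<inter> F. K x) \<union> (\<Union>x\<in>X. K x))"
    if "finite X" "X \<subseteq> Z - F" "good (\<Union>x\<in>Z \<inter> F. K x)" for X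
    using that
  proof (induction X rule: finite_induct)
    case (insert x X)
    then have IH: "good ((\<Union>x\<in>Z \<inter> F. K x) \<union> (\<Union>x\<in>X. K x))" by simp
    have "x \<in> topspace J" "x \<notin> F" using insert.prems Z(2) by auto
    with WK[of x] IH have "good (((\<Union>x\<in>Z \<inter> F. K x) \<union> (\<Union>x\<in>X. K x)) \<union> K x)" by simp
    moreover have "((\<Union>x\<in>Z \<inter> F. K x) \<union> (\<Union>x\<in>X. K x)) \<union> K x = (\<Union>x\<in>Z \<inter> F. K x) \<union> (\<Union>x\<in>insert x X. K x)"
      by auto
    ultimately show ?case by simp
  qed simp
  ultimately have "good ((\<Union>x\<in>Z \<inter> F. K x) \<union> (\<Union>x\<in>Z - F. K x))" using Z(1) by simp
  then obtain a where a: "\<forall>r<m. linear_functional J E (a r)"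
    "\<forall>x\<in>(\<Union>x\<in>Z \<inter> F. K x) \<union> (\<Union>x\<in>Z - F. K x). separates E (2 * m) (with_star m a) x"
    unfolding good_def by (elim conjE exE)
  have "topspace J \<subseteq> (\<Union>x\<in>Z \<inter> F. K x) \<union> (\<Union>x\<in>Z - F. K x)"
  proof
    fix y assume "y \<in> topspace J"
    then obtain x where "x \<in> Z" "y \<in> W x" using Z(3) by auto
    then have "y \<in> K x" using WK[of x] Z(2) by auto
    then show "y \<in> (\<Union>x\<in>Z \<inter> F. K x) \<union> (\<Union>x\<in>Z - F. K x)" using \<open>x \<in> Z\<close> by auto
  qed
  then have "separates E (2 * m) (with_star m a) x" if "x \<in> topspace J" for x using a(2) that by blast
  with a(1) show ?thesis by (intro exI[of _ a]) simp
qed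

text \<open>
  The \<open>r\<close>-th entry of \<open>\<Phi> u\<close> is the quaternion \<open>a r u - a r (\<iota>E u) j\<close>. Multiplied by \<open>j\<close> on the right it becomes
  \<open>a r (\<iota>E u) + a r u j\<close>, which is the entry of \<open>\<Phi> (\<iota>E u)\<close> since \<open>a r (\<iota>E (\<iota>E u)) = - a r u\<close>.
\<close>
lemma equivariant_monomorphism_of_separating_family:
  assumes a: "\<And>r. r < m \<Longrightarrow> linear_functional J E (a r)"
    and sep: "\<And>x. x \<in> topspace J \<Longrightarrow> separates E (2 * m) (with_star m a) x"
    and \<Phi>: "\<Phi> = (\<lambda>u. (proj E u, \<lambda>r. if r < m then (a r u, - a r (\<iota>E u)) else 0))"
  shows "bundle_monomorphism J E (trivial_quat_bundle J m) \<Phi>"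
    and "Pin2_equivariant \<iota>J E \<iota>E (trivial_quat_bundle J m) (trivial_quat_iota \<iota>J) \<Phi>"
    and "\<forall>u\<in>topspace (total E). \<Phi> (\<iota>E u) = trivial_quat_iota \<iota>J (\<Phi> u)"
proof -
  let ?H = "trivial_quat_bundle J m"
  have lin: "linear_on_fibre E x (a r)" if "r < m" "x \<in> topspace J" for r x
    using a[OF that(1)] that(2) by (simp add: linear_functional_def)
  have add: "a r (u \<oplus>\<^bsub>fib E x\<^esub> v) = a r u + a r v"
    if "r < m" "x \<in> topspace J" "u \<in> fibre x" "v \<in> fibre x" for r x u v
    using lin[OF that(1,2)] that(3,4) by (simp add: linear_on_fibre_def)
  have scale: "a r (c \<odot>\<^bsub>fib E x\<^esub> u) = c * a r u" if "r < m" "x \<in> topspace J" "u \<in> fibre x" for r x c u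
    using lin[OF that(1,2)] that(3) by (simp add: linear_on_fibre_def)
  have pr: "proj E u = x" if "x \<in> topspace J" "u \<in> fibre x" for x u using that fibre_eq by simp
  have \<Phi>_smult: "\<Phi> (c \<odot>\<^bsub>fib E x\<^esub> u) = c \<odot>\<^bsub>fib ?H x\<^esub> \<Phi> u" if x: "x \<in> topspace J" and u: "u \<in> fibre x" for x c u
    using \<iota>E_fibre[OF x u] \<iota>J_closed[OF x] u fibre_smult_closed[OF x u]
    by (auto simp: \<Phi> trivial_quat_bundle_def pr[OF x] \<iota>E_smult[OF x u] scale[OF _ x u] scale[OF _ \<iota>J_closed[OF x]] qmult_def fun_eq_iff mult.commute zero_prod_def)
  have \<Phi>_add: "\<Phi> (u \<oplus>\<^bsub>fib E x\<^esub> v) = \<Phi> u \<oplus>\<^bsub>fib ?H x\<^esub> \<Phi> v"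
    if x: "x \<in> topspace J" and u: "u \<in> fibre x" and v: "v \<in> fibre x" for x u v
    using \<iota>E_fibre[OF x u] \<iota>E_fibre[OF x v] fibre_add_closed[OF x u v]
    by (auto simp: \<Phi> trivial_quat_bundle_def pr[OF x] \<iota>E_add[OF x u v] add[OF _ x u v] add[OF _ \<iota>J_closed[OF x]] fun_eq_iff zero_prod_def)
  have \<Phi>_iota: "\<Phi> (\<iota>E u) = trivial_quat_iota \<iota>J (\<Phi> u)" if u: "u \<in> topspace (total E)" for u
  proof -
    define x where "x = proj E u"
    have x: "x \<in> topspace J" "u \<in> fibre x" using in_fibre_proj[OF u] by (auto simp: x_def)
    have "a r (\<iota>E (\<iota>E u)) = - a r u" if "r < m" for r
      using \<iota>E_square[OF x] linear_uminus[OF x(1) lin[OF that x(1)] x(2)] by simp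
    then show ?thesis
      by (auto simp: \<Phi> trivial_quat_iota_def proj_\<iota>E[OF u] qmult_def qj_def fun_eq_iff zero_prod_def)
  qed
  show "\<forall>u\<in>topspace (total E). \<Phi> (\<iota>E u) = trivial_quat_iota \<iota>J (\<Phi> u)" using \<Phi>_iota by simp
  have fst\<Phi>: "fst (\<Phi> u) = proj E u" for u by (simp add: \<Phi>)
  show "Pin2_equivariant \<iota>J E \<iota>E ?H (trivial_quat_iota \<iota>J) \<Phi>"
    unfolding Pin2_equivariant_def
  proof (intro ballI)
    fix g u assume u: "u \<in> topspace (total E)"
    have x: "proj E u \<in> topspace J" "u \<in> fibre (proj E u)" using in_fibre_proj[OF u] by auto
    have projH: "proj ?H (\<Phi> u) = proj E u" by (simp add: trivial_quat_bundle_def fst\<Phi>)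
    show "\<Phi> (Pin2_action \<iota>J E \<iota>E g u) = Pin2_action \<iota>J ?H (trivial_quat_iota \<iota>J) g (\<Phi> u)"
      unfolding Pin2_action_def projH
      using \<Phi>_smult[OF x] \<Phi>_smult[OF \<iota>J_closed[OF x(1)] \<iota>E_fibre[OF x]] \<Phi>_iota[OF u] by simp
  qed
  show "bundle_monomorphism J E ?H \<Phi>"
    unfolding bundle_monomorphism_def
  proof (intro conjI ballI allI)
    have comp: "continuous_map (total E) euclidean (\<lambda>u. if r < m then (a r u, - a r (\<iota>E u)) else 0 :: quat)" for r
    proof (cases "r < m")
      case True
      have "continuous_map (total E) euclidean (a r)" using a[OF True] by (simp add: linear_functional_def)
      moreover from continuous_map_compose[OF \<iota>E_continuous this]
      have "continuous_map (total E) euclidean (\<lambda>u. - a r (\<iota>E u))"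
        by (intro continuous_map_minus) (simp add: comp_def)
      ultimately have "continuous_map (total E) (prod_topology euclidean euclidean) (\<lambda>u. (a r u, - a r (\<iota>E u)))"
        by (rule continuous_map_pairedI)
      then show ?thesis using True by (simp add: euclidean_product_topology)
    qed simp
    have "continuous_map (total E) (coord_space m) (\<lambda>u r. if r < m then (a r u, - a r (\<iota>E u)) else 0 :: quat)"
      unfolding coord_space_def
      by (intro continuous_map_into_subtopology) (use comp in \<open>auto simp: continuous_map_componentwise_UNIV\<close>)
    then show "continuous_map (total E) (total ?H) \<Phi>"
      unfolding \<Phi> trivial_quat_bundle_def by (simp add: continuous_map_pairedI proj_continuous)
    show "proj ?H (\<Phi> u) = proj E u" for u by (simp add: trivial_quat_bundle_def fst\<Phi>)
    show "\<Phi> (u \<oplus>\<^bsub>fib E x\<^esub> v) = \<Phi> u \<oplus>\<^bsub>fib ?H x\<^esub> \<Phi> v"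
      if "x \<in> topspace J" "u \<in> fibre x" "v \<in> fibre x" for x u v by (rule \<Phi>_add[OF that])
    show "\<Phi> (c \<odot>\<^bsub>fib E x\<^esub> u) = c \<odot>\<^bsub>fib ?H x\<^esub> \<Phi> u"
      if "x \<in> topspace J" "u \<in> fibre x" for x u c by (rule \<Phi>_smult[OF that])
    show "inj_on \<Phi> (fibre x)" if x: "x \<in> topspace J" for x
    proof (rule inj_onI)
      fix u v assume u: "u \<in> fibre x" and v: "v \<in> fibre x" and eq: "\<Phi> u = \<Phi> v"
      have av: "a r u = a r v \<and> a r (\<iota>E u) = a r (\<iota>E v)" if "r < m" for r
        using eq that unfolding \<Phi> by (auto dest: fun_cong[of _ _ r])
      define w where "w = u \<oplus>\<^bsub>fib E x\<^esub> (\<ominus>\<^bsub>fib E x\<^esub> v)"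
      have nv: "\<ominus>\<^bsub>fib E x\<^esub> v \<in> fibre x" by (rule fibre_uminus_closed[OF x v])
      have w: "w \<in> fibre x" unfolding w_def by (rule fibre_add_closed[OF x u nv])
      have diff: "b w = b u - b v" if "linear_on_fibre E x b" for b
        using that u nv linear_uminus[OF x that v] unfolding w_def linear_on_fibre_def by simp
      have "a r w = 0 \<and> a r (\<iota>E w) = 0" if "r < m" for r
      proof -
        have "a r w = 0" using diff[OF lin[OF that x]] av[OF that] by simp
        moreover have "star (a r) w = 0"
          using diff[OF star_linear_on_fibre[OF x lin[OF that \<iota>J_closed[OF x]]]] av[OF that] by (simp add: star_def)
        ultimately show ?thesis by (simp add: star_def)
      qed
      then have "w = \<zero>\<^bsub>fib E x\<^esub>" using sep[OF x] w unfolding separates_def with_star_zero_iff by blast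
      then show "u = v" unfolding w_def by (rule fibre_eq_of_diff_zero[OF x u v])
    qed
  qed
qed

end

theorem theorem2p14:
  fixes J :: "'a topology" and A :: "('a set \<times> ('a \<Rightarrow> nat \<Rightarrow> real)) set" and \<iota>J :: "'a \<Rightarrow> 'a"
    and E :: "('a, 'e) vbundle" and \<iota>E :: "'e \<Rightarrow> 'e"
    and k l m :: nat
  assumes "compact_space J"
    and "smooth_manifold k J A"
    and "smooth_involution k J A \<iota>J"
    and "fixed_points J \<iota>J \<noteq> {}"
    and "isolated_set J (fixed_points J \<iota>J)"
    and "quaternionic_vector_bundle J \<iota>J E \<iota>E (2 * l)"
    and "m = l + (k + 2) div 4"
  shows "\<exists>\<Phi>. bundle_monomorphism J E (trivial_quat_bundle J m) \<Phi> \<and>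
           Pin2_equivariant \<iota>J E \<iota>E (trivial_quat_bundle J m) (trivial_quat_iota \<iota>J) \<Phi> \<and>
           (\<forall>u\<in>topspace (total E). \<Phi> (\<iota>E u) = trivial_quat_iota \<iota>J (\<Phi> u))"
proof -
  interpret quaternionic_bundle J E "2 * l" \<iota>J \<iota>E
  proof
    show "complex_vector_bundle J E (2 * l)" "quaternionic_structure J \<iota>J E \<iota>E"
      using assms(6) by (simp_all add: quaternionic_vector_bundle_def)
    show "continuous_map J J \<iota>J"
      using assms(3) unfolding smooth_involution_def smooth_map_def by (elim conjE)
    show "\<iota>J (\<iota>J x) = x" if "x \<in> topspace J" for x
      using assms(3) that by (simp add: smooth_involution_def)
  qed
  have charts: "\<exists>U \<phi>. x \<in> U \<and> chart k J (U, \<phi>)" if "x \<in> topspace J" for x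
  proof -
    have "x \<in> (\<Union>(U, \<phi>)\<in>A. U)" and "\<forall>c\<in>A. chart k J c"
      using assms(2) that by (simp_all add: smooth_manifold_def)
    then show ?thesis by blast
  qed
  have Haus: "Hausdorff_space J" using assms(2) by (simp add: smooth_manifold_def)
  \<comment> \<open>The codimension 4 (m - l) + 2 of the matrices that are not injective exceeds k.\<close>
  have dim: "k + 2 * (2 * l) < 2 * (2 * m) + 2" and lm: "l \<le> m" using assms(7) by presburger+
  have "\<exists>a. (\<forall>r<m. linear_functional J E (a r)) \<and>
      (\<forall>x\<in>topspace J. separates E (2 * m) (with_star m a) x)"
    by (rule separating_family_exists[OF assms(1) Haus refl lm dim _ assms(5)]) (rule charts)
  then obtain a where a: "\<forall>r<m. linear_functional J E (a r)"
      "\<forall>x\<in>topspace J. separates E (2 * m) (with_star m a) x"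
    by (elim exE conjE)
  note mono = equivariant_monomorphism_of_separating_family[OF a(1)[rule_format] a(2)[rule_format] refl]
  show ?thesis by (rule exI, intro conjI) (rule mono; assumption)+
qed

end
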